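(* Let $p_0,q_0,r_0,s_0\in\mathbb{N}\cup\{+\infty\}$ (with $0\in\mathbb{N}$). Then there exist two continuous weight-functions $m$ and $n$ on $[T_1,T_2]$ such that the spectrum $\Sigma^*$ associated to the problem $$Lu=a\,m(t)u^+-b\,n(t)u^-\ \text{in } ]T_1,T_2[,\qquad u'(T_1)=0=u'(T_2)$$ contains exactly $2p_0+1$ hyperbolic like curves in $\mathbb{R}_+\times\mathbb{R}_+$, exactly $2q_0+1$ in $\mathbb{R}_+\times\mathbb{R}_-$, exactly $2r_0+1$ in $\mathbb{R}_-\times\mathbb{R}_-$, and exactly $2s_0+1$ in $\mathbb{R}_-\times\mathbb{R}_+$.
   Context: Let $T_1<T_2$ be real numbers, $p,q\in C[T_1,T_2]$ with $p(t)>0$ and $q(t)\ge 0$ on $[T_1,T_2]$, and $Lu:=-[p(t)u']'+q(t)u$. Write $u^\pm:=\max\{\pm u,0\}$; $\mathbb{R}_+=[0,+\infty[$, $\mathbb{R}_-=\,]-\infty,0]$. Weight-functions $m,n\in C[T_1,T_2]$ are assumed $\not\equiv0$. For $k\ge0$, $C_k^>$ (resp. $C_k^<$) is the set of $(a,b)\in\mathbb{R}^2$ such that the problem in the claim has a nontrivial solution with exactly $k$ zeros in $]T_1,T_2[$ and with $u(T_2)>0$ (resp. $u(T_2)<0$). Put $\Sigma^*:=\bigcup_{k\ge1}(C_k^>\cup C_k^<)$. The number of hyperbolic like curves of $\Sigma^*$ in a quadrant $Q$ is the number (possibly $+\infty$) of nonempty sets among $C_k^>\cap Q$, $C_k^<\cap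 Q$, $k\ge1$; curves that coincide (double curves) are counted twice. Each such nonempty set is the graph of a strictly monotone $C^1$-diffeomorphism between two unbounded open intervals. *)

theory Defs
  imports "HOL-Analysis.Analysis" "HOL-Library.Extended_Nat"
begin

text \<open>
  Functions on \<open>[T1, T2]\<close> are represented by total functions on the reals; only their values
  on \<open>{T1..T2}\<close> are ever used.
\<close>

text \<open>
  Classical solutions of \<open>L u = a m u\<^sup>+ - b n u\<^sup>-\<close> in \<open>]T1, T2[\<close>, \<open>u'(T1) = 0 = u'(T2)\<close>,
  where \<open>L u = -(p u')' + q u\<close>. Since \<open>p\<close> is only continuous, \<open>u''\<close> need not exist: \<open>v\<close> is
  \<open>u'\<close> (one-sided at the end points) and \<open>w\<close> is the derivative of the flux \<open>p u'\<close>.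
\<close>

definition neumann_solution ::
  "real \<Rightarrow> real \<Rightarrow> (real \<Rightarrow> real) \<Rightarrow> (real \<Rightarrow> real) \<Rightarrow> (real \<Rightarrow> real) \<Rightarrow> (real \<Rightarrow> real) \<Rightarrow>
    real \<Rightarrow> real \<Rightarrow> (real \<Rightarrow> real) \<Rightarrow> bool"
where
  "neumann_solution T1 T2 p q m n a b u \<longleftrightarrow>
    (\<exists>v w.
      (\<forall>t\<in>{T1..T2}. (u has_real_derivative v t) (at t within {T1..T2})) \<and>
      continuous_on {T1..T2} v \<and>
      (\<forall>t\<in>{T1<..<T2}. ((\<lambda>s. p s * v s) has_real_derivative w t) (at t)) \<and>
      (\<forall>t\<in>{T1<..<T2}.
        - w t + q t * u t = a * m t * max (u t) 0 - b * n t * max (- u t) 0) \<and>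
      v T1 = 0 \<and> v T2 = 0)"

definition nontrivial_neumann_solution ::
  "real \<Rightarrow> real \<Rightarrow> (real \<Rightarrow> real) \<Rightarrow> (real \<Rightarrow> real) \<Rightarrow> (real \<Rightarrow> real) \<Rightarrow> (real \<Rightarrow> real) \<Rightarrow>
    real \<Rightarrow> real \<Rightarrow> (real \<Rightarrow> real) \<Rightarrow> bool"
where
  "nontrivial_neumann_solution T1 T2 p q m n a b u \<longleftrightarrow>
    neumann_solution T1 T2 p q m n a b u \<and> (\<exists>t\<in>{T1..T2}. u t \<noteq> 0)"

definition has_exactly_zeros :: "real \<Rightarrow> real \<Rightarrow> nat \<Rightarrow> (real \<Rightarrow> real) \<Rightarrow> bool" where
  "has_exactly_zeros T1 T2 k u \<longleftrightarrow>
    finite {t \<in> {T1<..<T2}. u t = 0} \<and> card {t \<in> {T1<..<T2}. u t = 0} = k"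

definition C_gt ::
  "real \<Rightarrow> real \<Rightarrow> (real \<Rightarrow> real) \<Rightarrow> (real \<Rightarrow> real) \<Rightarrow> (real \<Rightarrow> real) \<Rightarrow> (real \<Rightarrow> real) \<Rightarrow>
    nat \<Rightarrow> (real \<times> real) set"
where
  "C_gt T1 T2 p q m n k =
    {(a, b). \<exists>u. nontrivial_neumann_solution T1 T2 p q m n a b u \<and>
                 has_exactly_zeros T1 T2 k u \<and> u T2 > 0}"

definition C_lt ::
  "real \<Rightarrow> real \<Rightarrow> (real \<Rightarrow> real) \<Rightarrow> (real \<Rightarrow> real) \<Rightarrow> (real \<Rightarrow> real) \<Rightarrow> (real \<Rightarrow> real) \<Rightarrow>
    nat \<Rightarrow> (real \<times> real) set"
where
  "C_lt T1 T2 p q m n k =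
    {(a, b). \<exists>u. nontrivial_neumann_solution T1 T2 p q m n a b u \<and>
                 has_exactly_zeros T1 T2 k u \<and> u T2 < 0}"

definition ecard :: "'a set \<Rightarrow> enat" where
  "ecard A = (if finite A then enat (card A) else \<infinity>)"

text \<open>
  The number of hyperbolic like curves in \<open>Q\<close> of the spectrum \<open>\<Sigma>\<^sup>*\<close>, the union of all
  \<open>C_gt k\<close> and \<open>C_lt k\<close> with \<open>k \<ge> 1\<close>. Indices are counted rather than sets, so that
  coinciding curves are counted twice.
\<close>

definition num_hyperbolic_curves ::
  "real \<Rightarrow> real \<Rightarrow> (real \<Rightarrow> real) \<Rightarrow> (real \<Rightarrow> real) \<Rightarrow> (real \<Rightarrow> real) \<Rightarrow> (real \<Rightarrow> real) \<Rightarrow>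
    (real \<times> real) set \<Rightarrow> enat"
where
  "num_hyperbolic_curves T1 T2 p q m n Q =
    ecard {k. k \<ge> 1 \<and> C_gt T1 T2 p q m n k \<inter> Q \<noteq> {}} +
    ecard {k. k \<ge> 1 \<and> C_lt T1 T2 p q m n k \<inter> Q \<noteq> {}}"

end

theory Submission
  imports Defs
begin

text \<open>
  On a nodal interval where \<open>u > 0\<close> the flux \<open>p u'\<close> would be monotone if \<open>a m \<le> 0\<close> there, which is
  incompatible with the boundary values; so \<open>a m\<close> is positive somewhere, and likewise \<open>b n\<close>
  where \<open>u < 0\<close>. Hence a solution with \<open>k\<close> zeros yields \<open>k + 1\<close> points at which \<open>a m\<close> and \<open>b n\<close> are
  alternately positive. Conversely, given such points in a quadrant with signs \<open>(\<sigma>, \<tau>)\<close>, put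
  \<open>(a, b) = (c \<sigma>, c \<tau>)\<close> and start the Pruefer angle at \<open>- k \<pi>\<close>: its end value is less than \<open>0\<close> for
  \<open>c = 0\<close> and, passing all the points, greater than \<open>0\<close> for large \<open>c\<close>, so it equals \<open>0\<close> for some \<open>c\<close>,
  which gives a solution with exactly \<open>k\<close> zeros and \<open>u T2 > 0\<close>. Thus the number of curves
  depends only on the order of the signs of \<open>m\<close> and \<open>n\<close>, and any four odd numbers can be realised by
  piecewise choice of these signs.
\<close>

section \<open>Alternating chains and words\<close>

text \<open>Only the nonemptiness of each curve in a quadrant is counted, so one point per curve
  suffices. Seeking it on the diagonal ray of the quadrant turns the two-parameter problem into
  shooting with one parameter \<open>c\<close>. Large \<open>c\<close> makes up for small or short
  positive parts of a weight, so sizes and lengths drop out and only the order of the signs is left.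
  A chain of two or more points needs both \<open>a\<close> and \<open>b\<close> to be nonzero;
  hence the axes, which the closed quadrants share, contain no point of any of these curves.

  The oddness has a simple cause. For a word, once a quadrant has seen both weights with the right
  sign, the largest chain lengths \<open>A\<close> and \<open>B\<close>, if finite, differ by
  exactly one, so \<open>(A - 1) + (B - 1)\<close> is odd. The obstacle is interference: each sign
  of \<open>m\<close> and each sign of \<open>n\<close> is seen by two quadrants, so the four
  numbers cannot be built by four unrelated pieces.\<close>

fun alt_chain :: "(real \<Rightarrow> bool) \<Rightarrow> (real \<Rightarrow> bool) \<Rightarrow> nat \<Rightarrow> real \<Rightarrow> bool" where
  "alt_chain f g 0 x \<longleftrightarrow> True"
| "alt_chain f g (Suc k) x \<longleftrightarrow> (\<exists>t<x. f t \<and> alt_chain g f k t)"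

lemma alt_chain_mono:
  assumes "alt_chain f g k x" "x \<le> y"
  shows "alt_chain f g k y"
  using assms by (cases k) (auto intro: less_le_trans)

lemma alt_chain_weaken:
  assumes "alt_chain f g k x"
    and "\<And>t. t < x \<Longrightarrow> f t \<Longrightarrow> f' t" and "\<And>t. t < x \<Longrightarrow> g t \<Longrightarrow> g' t"
  shows "alt_chain f' g' k x"
  using assms
proof (induction k arbitrary: f g f' g' x)
  case (Suc k)
  then obtain t where t: "t < x" "f t" "alt_chain g f k t" by auto
  have "alt_chain g' f' k t" using Suc.IH[OF t(3)] Suc.prems t by auto
  then show ?case using t Suc.prems(2) by auto
qed simp

text \<open>
  A letter \<open>(s, t)\<close> stands for a block on which the two weights have the signs \<open>s\<close> and \<open>t\<close>. In the
  state \<open>(A, B)\<close>, \<open>A\<close> and \<open>B\<close> are the largest lengths of chains in the blocks read so far that end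
  with the first and with the second weight.
\<close>

fun chain_step :: "real \<Rightarrow> real \<Rightarrow> enat \<times> enat \<Rightarrow> real \<times> real \<Rightarrow> enat \<times> enat" where
  "chain_step \<sigma> \<tau> (A, B) (s, t) =
    (if \<sigma> * s > 0 \<and> \<tau> * t > 0 then (\<infinity>, \<infinity>)
     else if \<sigma> * s > 0 then (max A (B + 1), B)
     else if \<tau> * t > 0 then (A, max B (A + 1))
     else (A, B))"

section \<open>Effect of one block on the chain lengths\<close>

lemma alt_chain_skip:
  assumes "\<And>t. y \<le> t \<Longrightarrow> t < z \<Longrightarrow> \<not> f t" and "y < z"
  shows "alt_chain f g k z \<longleftrightarrow> alt_chain f g k y"
proof (cases k)
  case (Suc j)
  have "(\<exists>t<z. f t \<and> alt_chain g f j t) \<longleftrightarrow> (\<exists>t<y. f t \<and> alt_chain g f j t)"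
    using assms by (meson less_trans not_le)
  then show ?thesis by (simp add: Suc)
qed simp

text \<open>Since \<open>g\<close> fails throughout the block, a chain can place at most one point
  there, and that point must be its last. The two disjuncts, last point before or inside the block,
  correspond to \<open>A\<close> and \<open>B + 1\<close> in \<open>chain_step\<close>.\<close>

lemma alt_chain_extend:
  assumes "y < z" "\<And>t. y \<le> t \<Longrightarrow> t < z \<Longrightarrow> \<not> g t" "\<not> f y" "\<And>t. y < t \<Longrightarrow> t < z \<Longrightarrow> f t"
  shows "alt_chain f g (Suc k) z \<longleftrightarrow> alt_chain f g (Suc k) y \<or> alt_chain g f k y"
proof
  assume "alt_chain f g (Suc k) z"
  then obtain t where t: "t < z" "f t" "alt_chain g f k t" by auto
  have "alt_chain g f k y" using alt_chain_mono[OF t(3)] alt_chain_skip[of y z g f k] assms t by auto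
  then show "alt_chain f g (Suc k) y \<or> alt_chain g f k y" by blast
next
  assume "alt_chain f g (Suc k) y \<or> alt_chain g f k y"
  then show "alt_chain f g (Suc k) z"
  proof
    assume "alt_chain f g (Suc k) y"
    then show ?thesis using alt_chain_mono assms(1) less_imp_le by blast
  next
    assume *: "alt_chain g f k y"
    obtain t where t: "y < t" "t < z" using assms(1) dense by blast
    then have "alt_chain g f k t" using alt_chain_mono[OF *] by simp
    then show ?thesis using assms(4) t by auto
  qed
qed

lemma alt_chain_unbounded:
  assumes "y < z" "\<And>t. y < t \<Longrightarrow> t < z \<Longrightarrow> f t" "\<And>t. y < t \<Longrightarrow> t < z \<Longrightarrow> g t"
  shows "alt_chain f g k z"
  using assms
proof (induction k arbitrary: f g z)
  case (Suc k)
  obtain t where t: "y < t" "t < z" using Suc.prems(1) dense by blast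
  then have "alt_chain g f k t" by (intro Suc.IH) (use Suc.prems t in auto)
  then show ?case using Suc.prems t by auto
qed simp

lemma enat_Suc_le_max: "enat (Suc k) \<le> max A (B + 1) \<longleftrightarrow> enat (Suc k) \<le> A \<or> enat k \<le> B"
proof -
  have "enat (Suc k) \<le> B + 1 \<longleftrightarrow> enat k \<le> B" by (cases B) (auto simp: one_enat_def)
  then show ?thesis by (simp add: le_max_iff_disj)
qed

text \<open>Here \<open>y\<close> and \<open>z\<close> are the ends of a block. The weights will
  vanish at grid points, so neither predicate holds at \<open>y\<close> and the block acts only
  through its open interior.\<close>

lemma alt_chain_step:
  assumes yz: "y < z" and y: "\<not> f y" "\<not> g y"
    and f: "\<And>t. y < t \<Longrightarrow> t < z \<Longrightarrow> f t \<longleftrightarrow> \<sigma> * s > 0"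
    and g: "\<And>t. y < t \<Longrightarrow> t < z \<Longrightarrow> g t \<longleftrightarrow> \<tau> * r > 0"
    and A: "\<And>k. alt_chain f g k y \<longleftrightarrow> enat k \<le> A"
    and B: "\<And>k. alt_chain g f k y \<longleftrightarrow> enat k \<le> B"
    and step: "chain_step \<sigma> \<tau> (A, B) (s, r) = (A', B')"
  shows "(alt_chain f g k z \<longleftrightarrow> enat k \<le> A') \<and> (alt_chain g f k z \<longleftrightarrow> enat k \<le> B')"
proof -
  have nf: "\<not> f t" if "\<not> \<sigma> * s > 0" "y \<le> t" "t < z" for t using that y f by (cases "t = y") auto
  have ng: "\<not> g t" if "\<not> \<tau> * r > 0" "y \<le> t" "t < z" for t using that y g by (cases "t = y") auto
  consider (both) "\<sigma> * s > 0" "\<tau> * r > 0" | (f) "\<sigma> * s > 0" "\<not> \<tau> * r > 0"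
    | (g) "\<not> \<sigma> * s > 0" "\<tau> * r > 0" | (none) "\<not> \<sigma> * s > 0" "\<not> \<tau> * r > 0" by blast
  then show ?thesis
  proof cases
    case both
    then show ?thesis using alt_chain_unbounded[OF yz, of f g k] alt_chain_unbounded[OF yz, of g f k] f g step
      by auto
  next
    case f': f
    have 1: "alt_chain g f k z \<longleftrightarrow> alt_chain g f k y" using alt_chain_skip ng f' yz by blast
    have 2: "alt_chain f g k z \<longleftrightarrow> enat k \<le> max A (B + 1)"
    proof (cases k)
      case (Suc j)
      show ?thesis unfolding Suc using alt_chain_extend[of y z g f j] ng f' yz y f A B
        by (simp only: enat_Suc_le_max) blast
    qed (simp add: enat_0)
    show ?thesis using 1 2 step f' B by auto
  next
    case g': g
    have 1: "alt_chain f g k z \<longleftrightarrow> alt_chain f g k y" using alt_chain_skip nf g' yz by blast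
    have 2: "alt_chain g f k z \<longleftrightarrow> enat k \<le> max B (A + 1)"
    proof (cases k)
      case (Suc j)
      show ?thesis unfolding Suc using alt_chain_extend[of y z f g j] nf g' yz y g A B
        by (simp only: enat_Suc_le_max) blast
    qed (simp add: enat_0)
    show ?thesis using 1 2 step g' A by auto
  next
    case none
    have "alt_chain f g k z \<longleftrightarrow> alt_chain f g k y" "alt_chain g f k z \<longleftrightarrow> alt_chain g f k y"
      using alt_chain_skip nf ng none yz by blast+
    then show ?thesis using step none A B by auto
  qed
qed

text \<open>
  Infinitely many pairs of consecutive blocks are replaced by a single block on which both weights
  have the desired sign: there chains alternate arbitrarily often.
\<close>

fun pairs :: "enat \<Rightarrow> real \<Rightarrow> real \<Rightarrow> (real \<times> real) list" where
  "pairs (enat n) x y = concat (replicate n [(x, 0), (0, y)])"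
| "pairs \<infinity> x y = [(x, y)]"

definition opt :: "bool \<Rightarrow> 'a \<Rightarrow> 'a list" where
  "opt b x = (if b then [x] else [])"

text \<open>\<open>B = A + 1\<close> means that the longest chain so far ends with the second
  weight, so that the first letter of the next pair extends it; otherwise this letter would only
  repeat the last sign. Each pair preserves the relation.\<close>

lemma foldl_pairs_both:
  assumes "\<sigma> * x > 0" "\<tau> * y > 0" "B = A + 1"
  shows "foldl (chain_step \<sigma> \<tau>) (A, B) (pairs N x y) = (A + 2 * N, B + 2 * N)"
proof (cases N)
  case (enat n)
  have "foldl (chain_step \<sigma> \<tau>) (A, B) (concat (replicate n [(x, 0), (0, y)])) =
      (A + 2 * enat n, B + 2 * enat n)"
    using assms(3)
  proof (induction n arbitrary: A B)
    case (Suc n)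
    have "chain_step \<sigma> \<tau> (chain_step \<sigma> \<tau> (A, B) (x, 0)) (0, y) = (A + 2, A + 3)"
      using assms Suc.prems by (cases A) (auto simp: one_enat_def numeral_eq_enat)
    then have "foldl (chain_step \<sigma> \<tau>) (A, B) (concat (replicate (Suc n) [(x, 0), (0, y)])) =
        foldl (chain_step \<sigma> \<tau>) (A + 2, A + 3) (concat (replicate n [(x, 0), (0, y)]))"
      by (simp del: chain_step.simps)
    also have "\<dots> = (A + 2 + 2 * enat n, A + 3 + 2 * enat n)"
      by (intro Suc.IH) (cases A; auto simp: one_enat_def numeral_eq_enat)
    also have "\<dots> = (A + 2 * enat (Suc n), B + 2 * enat (Suc n))"
      unfolding Suc.prems by (cases A; auto simp: one_enat_def numeral_eq_enat)
    finally show ?case .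
  qed (simp add: enat_0)
  then show ?thesis using enat by simp
next
  case infinity
  then show ?thesis using assms by (simp add: imult_is_infinity numeral_eq_enat)
qed

text \<open>A quadrant blind to the second letters sees one sign repeated. The update
  \<open>max A (B + 1)\<close> is idempotent as long as \<open>B\<close> is fixed, so all that
  matters is whether there is a pair at all.\<close>

lemma foldl_pairs_fst:
  assumes "\<sigma> * x > 0" "\<not> \<tau> * y > 0"
  shows "foldl (chain_step \<sigma> \<tau>) (A, B) (pairs N x y) =
    (if N = 0 then (A, B) else (max A (B + 1), B))"
proof (cases N)
  case (enat n)
  have "foldl (chain_step \<sigma> \<tau>) (A, B) (concat (replicate n [(x, 0), (0, y)])) =
      (if n = 0 then (A, B) else (max A (B + 1), B))"
    using assms by (induction n arbitrary: A) auto
  then show ?thesis using enat by (simp add: zero_enat_def)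
qed (use assms in simp)

lemma foldl_pairs_snd:
  assumes "\<not> \<sigma> * x > 0" "\<tau> * y > 0"
  shows "foldl (chain_step \<sigma> \<tau>) (A, B) (pairs N x y) =
    (if N = 0 then (A, B) else (A, max B (A + 1)))"
proof (cases N)
  case (enat n)
  have "foldl (chain_step \<sigma> \<tau>) (A, B) (concat (replicate n [(x, 0), (0, y)])) =
      (if n = 0 then (A, B) else (A, max B (A + 1)))"
    using assms by (induction n arbitrary: B) auto
  then show ?thesis using enat by (simp add: zero_enat_def)
qed (use assms in simp)

lemma foldl_pairs_none:
  assumes "\<not> \<sigma> * x > 0" "\<not> \<tau> * y > 0"
  shows "foldl (chain_step \<sigma> \<tau>) (A, B) (pairs N x y) = (A, B)"
proof (cases N)
  case (enat n)
  have "foldl (chain_step \<sigma> \<tau>) (A, B) (concat (replicate n [(x, 0), (0, y)])) = (A, B)"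
    using assms by (induction n) auto
  then show ?thesis using enat by simp
qed (use assms in simp)

text \<open>A chain of length \<open>k + 1\<close> corresponds to a solution with \<open>k\<close> zeros.\<close>

definition count_word :: "real \<Rightarrow> real \<Rightarrow> (real \<times> real) list \<Rightarrow> enat" where
  "count_word \<sigma> \<tau> w = (case foldl (chain_step \<sigma> \<tau>) (0, 0) w of (A, B) \<Rightarrow> (A - 1) + (B - 1))"

text \<open>A pair of letters lengthens both chains by two and thus raises the count by four,
  whereas consecutive odd targets differ by two. The remainder \<open>d\<close> is realised by one
  optional letter, which raises the count by two.\<close>

lemma enat_half: obtains N d where "e = 2 * N + (if d then 1 else 0 :: enat)"
proof (cases e)
  case (enat n)
  have "e = 2 * enat (n div 2) + (if odd n then 1 else 0)"
    using enat by (auto simp: one_enat_def zero_enat_def numeral_eq_enat)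
  then show ?thesis by (rule that)
next
  case infinity
  then have "e = 2 * \<infinity> + (if False then 1 else 0)" by (simp add: imult_is_infinity numeral_eq_enat)
  then show ?thesis by (rule that)
qed

text \<open>
  Each of the four lists of pairs below is seen by one quadrant as arbitrarily many alternations, and by
  each of the others as at most one sign, which repeats the sign that this quadrant sees next to it.
  The only loss is that the positive \<open>m\<close> at the end, present if \<open>p0 > 0\<close>, adds one alternation in the
  second quadrant; hence the assumption.
\<close>

lemma exists_word_aux:
  assumes "p0 = 0 \<or> q0 \<noteq> (0::enat)"
  shows "\<exists>w. count_word 1 1 w = 2 * p0 + 1 \<and> count_word 1 (-1) w = 2 * q0 + 1 \<and>
    count_word (-1) (-1) w = 2 * r0 + 1 \<and> count_word (-1) 1 w = 2 * s0 + 1"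
proof -
  define e where "e = (if p0 = 0 then 0 else 1 :: enat)"
  obtain P \<pi> where P: "p0 = 2 * P + (if \<pi> then 1 else 0)" by (rule enat_half)
  obtain R \<rho> where R: "r0 = 2 * R + (if \<rho> then 1 else 0)" by (rule enat_half)
  obtain S \<sigma> where S: "s0 = 2 * S + (if \<sigma> then 1 else 0)" by (rule enat_half)
  obtain Q \<kappa> where Q': "q0 - e = 2 * Q + (if \<kappa> then 1 else 0)" by (rule enat_half)
  have Q: "q0 = 2 * Q + (if \<kappa> then 1 else 0) + e"
    using assms Q' unfolding e_def
    by (cases q0; cases Q) (auto simp: one_enat_def zero_enat_def numeral_eq_enat split: if_splits)
  \<comment> \<open>The letters \<open>(1, 0), (0, -1)\<close> and \<open>(-1, 0), (0, 1)\<close>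
    alone give every quadrant the count one. Their placement also brings each quadrant into a state
    with \<open>B = A + 1\<close> just before its own list of pairs.\<close>
  define w where "w = opt \<rho> (-1, 0) @ opt \<kappa> (0, -1) @ [(1, 0), (0, -1)] @ pairs Q 1 (-1) @
    pairs R (-1) (-1) @ [(-1, 0), (0, 1)] @ pairs S (-1) 1 @ pairs P 1 1 @ opt \<pi> (1, 0) @ opt \<sigma> (-1, 0)"
  note fp = foldl_pairs_both foldl_pairs_fst foldl_pairs_snd foldl_pairs_none
  note ea = one_enat_def zero_enat_def numeral_eq_enat
  have 1: "count_word 1 1 w = 2 * p0 + 1"
    unfolding count_word_def w_def opt_def foldl_append P
    by (cases P; cases \<rho>; cases \<kappa>; cases \<pi>; cases \<sigma>) (simp_all add: fp ea del: pairs.simps)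
  have 2: "count_word 1 (-1) w = 2 * q0 + 1"
    unfolding count_word_def w_def opt_def foldl_append Q e_def P
    by (cases Q; cases P; cases \<rho>; cases \<kappa>; cases \<pi>; cases \<sigma>) (simp_all add: fp ea del: pairs.simps)
  have 3: "count_word (-1) (-1) w = 2 * r0 + 1"
    unfolding count_word_def w_def opt_def foldl_append R
    by (cases R; cases \<rho>; cases \<kappa>; cases \<pi>; cases \<sigma>) (simp_all add: fp ea del: pairs.simps)
  have 4: "count_word (-1) 1 w = 2 * s0 + 1"
    unfolding count_word_def w_def opt_def foldl_append S
    by (cases S; cases \<rho>; cases \<kappa>; cases \<pi>; cases \<sigma>) (simp_all add: fp ea del: pairs.simps)
  show ?thesis using 1 2 3 4 by blast
qed

lemma count_word_flip:
  "count_word \<sigma> \<tau> (map (\<lambda>(s, t). (s, - t)) w) = count_word \<sigma> (- \<tau>) w"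
proof -
  have "foldl (chain_step \<sigma> \<tau>) x (map (\<lambda>(s, t). (s, - t)) w) = foldl (chain_step \<sigma> (- \<tau>)) x w" for x
    by (induction w arbitrary: x) (auto split: prod.splits)
  then show ?thesis by (simp add: count_word_def)
qed

text \<open>Reversing the sign of the second weight exchanges \<open>p0\<close> with
  \<open>q0\<close> and \<open>r0\<close> with \<open>s0\<close>. In the case left open
  \<open>q0 = 0\<close>, so the exchanged numbers satisfy the assumption of
  \<open>exists_word_aux\<close>.\<close>

lemma exists_word:
  "\<exists>w. count_word 1 1 w = 2 * p0 + 1 \<and> count_word 1 (-1) w = 2 * q0 + 1 \<and>
    count_word (-1) (-1) w = 2 * r0 + 1 \<and> count_word (-1) 1 w = 2 * s0 + 1"
proof (cases "p0 = 0 \<or> q0 \<noteq> 0")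
  case True
  then show ?thesis by (rule exists_word_aux)
next
  case False
  then obtain w where "count_word 1 1 w = 2 * q0 + 1" "count_word 1 (-1) w = 2 * p0 + 1"
    "count_word (-1) (-1) w = 2 * s0 + 1" "count_word (-1) 1 w = 2 * r0 + 1"
    using exists_word_aux[of q0 p0 s0 r0] by auto
  then show ?thesis
    by (intro exI[of _ "map (\<lambda>(s, t). (s, - t)) w"]) (simp add: count_word_flip)
qed


section \<open>Weights built from words\<close>

text \<open>Adjacent blocks may carry opposite signs. Each value is therefore multiplied by the
  positive part of \<open>x * (1 - x)\<close>, with \<open>x\<close> the rescaled position in its
  cell, which keeps the sign inside the cell and makes the sum continuous.\<close>

definition blocks :: "real \<Rightarrow> real \<Rightarrow> real list \<Rightarrow> real \<Rightarrow> real" where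
  "blocks T h l t = (\<Sum>i<length l. l ! i * max 0 (((t - T) / h - i) * (1 - ((t - T) / h - i))))"

lemma continuous_on_blocks: "continuous_on S (blocks T h l)"
  unfolding blocks_def[abs_def] divide_inverse by (intro continuous_intros)

lemma bump_nonpos:
  fixes x :: real
  assumes "x \<le> 0 \<or> 1 \<le> x"
  shows "max 0 (x * (1 - x)) = 0"
proof -
  have "x * (1 - x) \<le> 0" using assms by (auto simp: mult_le_0_iff)
  then show ?thesis by simp
qed

lemma blocks_grid:
  assumes "h > 0"
  shows "blocks T h l (T + real i * h) = 0"
  unfolding blocks_def
proof (rule sum.neutral, safe)
  fix j
  have "real i - real j \<le> 0 \<or> 1 \<le> real i - real j"
    by (cases "i \<le> j") linarith+
  from bump_nonpos[OF this]
  show "l ! j * max 0 (((T + real i * h - T) / h - real j) * (1 - ((T + real i * h - T) / h - real j))) = 0"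
    using assms by simp
qed

lemma blocks_inside:
  assumes h: "h > 0" and i: "i < length l" and t: "T + real i * h < t" "t < T + real (Suc i) * h"
  obtains c where "c > 0" "blocks T h l t = l ! i * c"
proof -
  define x where "x = (t - T) / h"
  have x: "real i < x" "x < real i + 1"
    using h t by (simp_all add: x_def field_simps)
  define B where "B j = max 0 ((x - real j) * (1 - (x - real j)))" for j
  have B0: "B j = 0" if "j \<noteq> i" for j
    unfolding B_def
  proof (rule bump_nonpos)
    show "x - real j \<le> 0 \<or> 1 \<le> x - real j"
    proof (cases "j < i")
      case True
      then have "real j + 1 \<le> real i" by linarith
      then show ?thesis using x by linarith
    next
      case False
      then have "real i + 1 \<le> real j" using that by linarith
      then show ?thesis using x by linarith
    qed
  qed
  have "B i > 0" unfolding B_def using x by (auto simp: max_def mult_less_0_iff not_le mult_pos_pos)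
  moreover have "blocks T h l t = (\<Sum>j<length l. l ! j * B j)"
    by (simp add: blocks_def B_def x_def)
  moreover have "\<dots> = (\<Sum>j<length l. if j = i then l ! i * B i else 0)"
    by (rule sum.cong) (auto simp: B0)
  moreover have "\<dots> = l ! i * B i" using i by simp
  ultimately show ?thesis using that by simp
qed

text \<open>The argument of \<open>alt_chain\<close> bounds a chain from above only;
  \<open>T < t\<close> bounds it from below, so that values to the left of the interval cannot
  enter.\<close>

definition signed_above :: "real \<Rightarrow> real \<Rightarrow> (real \<Rightarrow> real) \<Rightarrow> real \<Rightarrow> bool" where
  "signed_above T \<sigma> m t \<longleftrightarrow> T < t \<and> \<sigma> * m t > 0"

lemma alt_chain_blocks:
  fixes w :: "(real \<times> real) list" and T :: real
  assumes h: "h > 0" and i: "i \<le> length w"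
    and st: "foldl (chain_step \<sigma> \<tau>) (0, 0) (take i w) = (A, B)"
  defines "f \<equiv> signed_above T \<sigma> (blocks T h (map fst w))"
    and "g \<equiv> signed_above T \<tau> (blocks T h (map snd w))"
  shows "(alt_chain f g k (T + i * h) \<longleftrightarrow> enat k \<le> A) \<and> (alt_chain g f k (T + i * h) \<longleftrightarrow> enat k \<le> B)"
  using i st
proof (induction i arbitrary: A B k)
  case 0
  then show ?case by (cases k) (auto simp: f_def g_def signed_above_def zero_enat_def)
next
  case (Suc i)
  obtain A0 B0 where AB: "foldl (chain_step \<sigma> \<tau>) (0, 0) (take i w) = (A0, B0)" by fastforce
  obtain s r where sr: "w ! i = (s, r)" by fastforce
  have "chain_step \<sigma> \<tau> (A0, B0) (s, r) = (A, B)"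
    using Suc.prems AB sr by (simp add: take_Suc_conv_app_nth)
  then show ?case
  proof (rule alt_chain_step[where y = "T + i * h", rotated 7])
    show "T + real i * h < T + real (Suc i) * h" using h by simp
    show "\<not> f (T + i * h)" "\<not> g (T + i * h)" using h by (simp_all add: f_def g_def signed_above_def blocks_grid)
    show "alt_chain f g k (T + real i * h) = (enat k \<le> A0)"
      "alt_chain g f k (T + real i * h) = (enat k \<le> B0)" for k
      using Suc.IH[OF _ AB] Suc.prems by auto
    fix t assume t: "T + real i * h < t" "t < T + real (Suc i) * h"
    have T: "T < t" using t h by (smt (verit) mult_nonneg_nonneg of_nat_0_le_iff)
    obtain c where c: "c > 0" "blocks T h (map fst w) t = s * c"
      using blocks_inside[of h i "map fst w" T t] h t Suc.prems sr by auto
    show "f t \<longleftrightarrow> 0 < \<sigma> * s"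
      using c T by (simp add: f_def signed_above_def zero_less_mult_iff mult_less_0_iff)
    obtain c where c: "c > 0" "blocks T h (map snd w) t = r * c"
      using blocks_inside[of h i "map snd w" T t] h t Suc.prems sr by auto
    show "g t \<longleftrightarrow> 0 < \<tau> * r"
      using c T by (simp add: g_def signed_above_def zero_less_mult_iff mult_less_0_iff)
  qed
qed

text \<open>The indices start at \<open>k = 1\<close>, so a chain of length one yields nothing;
  truncated subtraction also covers \<open>A = 0\<close>.\<close>

lemma ecard_below: "ecard {k. 1 \<le> k \<and> enat (Suc k) \<le> A} = A - 1"
proof (cases A)
  case (enat n)
  have "{k. 1 \<le> k \<and> enat (Suc k) \<le> A} = {1..<n}" using enat by auto
  then show ?thesis using enat by (simp add: ecard_def one_enat_def)
next
  case infinity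
  have "\<not> finite {1::nat..}" by (simp add: infinite_Ici)
  then show ?thesis using infinity by (simp add: ecard_def atLeast_def one_enat_def)
qed

lemma ecard_alt_chain_blocks:
  fixes w :: "(real \<times> real) list" and T1 T2 \<sigma> \<tau> :: real
  assumes "T1 < T2" "w \<noteq> []"
  defines "h \<equiv> (T2 - T1) / real (length w)"
  defines "f \<equiv> signed_above T1 \<sigma> (blocks T1 h (map fst w))"
    and "g \<equiv> signed_above T1 \<tau> (blocks T1 h (map snd w))"
  shows "ecard {k. 1 \<le> k \<and> alt_chain f g (Suc k) T2} + ecard {k. 1 \<le> k \<and> alt_chain g f (Suc k) T2}
    = count_word \<sigma> \<tau> w"
proof -
  have h: "h > 0" "T1 + length w * h = T2" using assms by (simp_all add: h_def)
  obtain A B where AB: "foldl (chain_step \<sigma> \<tau>) (0, 0) w = (A, B)" by fastforce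
  have "(alt_chain f g k T2 \<longleftrightarrow> enat k \<le> A) \<and> (alt_chain g f k T2 \<longleftrightarrow> enat k \<le> B)" for k
    using alt_chain_blocks[OF h(1) order_refl, where w = w and \<sigma> = \<sigma> and \<tau> = \<tau> and T = T1 and A = A and B = B and k = k] AB h(2)
    by (simp add: f_def g_def)
  then have "(\<lambda>k. alt_chain f g k T2) = (\<lambda>k. enat k \<le> A)" "(\<lambda>k. alt_chain g f k T2) = (\<lambda>k. enat k \<le> B)"
    by auto
  then have "alt_chain f g (Suc k) T2 \<longleftrightarrow> enat (Suc k) \<le> A" "alt_chain g f (Suc k) T2 \<longleftrightarrow> enat (Suc k) \<le> B" for k
    by metis+
  then show ?thesis using AB by (simp only: ecard_below count_word_def prod.case)
qed


section \<open>Nodal intervals of solutions\<close>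

locale sturm =
  fixes T1 T2 :: real and p q :: "real \<Rightarrow> real"
  assumes T1_less_T2: "T1 < T2"
    and cont_p: "continuous_on {T1..T2} p"
    and cont_q: "continuous_on {T1..T2} q"
    and p_pos: "\<And>t. t \<in> {T1..T2} \<Longrightarrow> p t > 0"
    and q_nonneg: "\<And>t. t \<in> {T1..T2} \<Longrightarrow> q t \<ge> 0"
begin

text \<open>\<open>F\<close> and \<open>G\<close> stand for \<open>a * m\<close> and
  \<open>b * n\<close>. With parameter and weight merged, passing to \<open>- u\<close> just
  exchanges \<open>F\<close> and \<open>G\<close>, so it is enough to study intervals on which
  \<open>u\<close> is positive.\<close>

definition solution ::
  "(real \<Rightarrow> real) \<Rightarrow> (real \<Rightarrow> real) \<Rightarrow> (real \<Rightarrow> real) \<Rightarrow> (real \<Rightarrow> real) \<Rightarrow> (real \<Rightarrow> real) \<Rightarrow> bool"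
where
  "solution F G u v w \<longleftrightarrow>
    (\<forall>t\<in>{T1..T2}. (u has_real_derivative v t) (at t within {T1..T2})) \<and>
    continuous_on {T1..T2} v \<and>
    (\<forall>t\<in>{T1<..<T2}. ((\<lambda>s. p s * v s) has_real_derivative w t) (at t)) \<and>
    (\<forall>t\<in>{T1<..<T2}. w t = q t * u t - (F t * max (u t) 0 - G t * max (- u t) 0))"

lemma solution_minus:
  assumes "solution F G u v w"
  shows "solution G F (\<lambda>t. - u t) (\<lambda>t. - v t) (\<lambda>t. - w t)"
  using assms unfolding solution_def
  by (auto intro!: DERIV_minus[where f = "\<lambda>s. p s * v s", simplified] DERIV_minus continuous_on_minus simp del: minus_diff_eq)

lemma solution_deriv:
  assumes "solution F G u v w" "T1 < t" "t < T2"
  shows "(u has_real_derivative v t) (at t)"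
proof -
  have "(u has_real_derivative v t) (at t within {T1..T2})" using assms by (simp add: solution_def)
  then show ?thesis using at_within_Icc_at[OF assms(2,3)] by simp
qed

lemma solution_continuous:
  assumes "solution F G u v w"
  shows "continuous_on {T1..T2} u" "continuous_on {T1..T2} (\<lambda>t. p t * v t)"
proof -
  show "continuous_on {T1..T2} u"
    using assms by (intro DERIV_continuous_on) (auto simp: solution_def)
  show "continuous_on {T1..T2} (\<lambda>t. p t * v t)"
    using assms by (auto simp: solution_def intro!: continuous_on_mult cont_p)
qed

section \<open>Uniqueness at a double zero\<close>

lemma continuous_bound:
  fixes f :: "real \<Rightarrow> real"
  assumes "continuous_on {T1..T2} f"
  obtains K where "K > 0" "\<And>t. t \<in> {T1..T2} \<Longrightarrow> \<bar>f t\<bar> \<le> K"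
proof -
  have "compact (f ` {T1..T2})" using assms by (intro compact_continuous_image) auto
  then obtain K where "K > 0" "\<forall>x\<in>f ` {T1..T2}. norm x \<le> K"
    using compact_imp_bounded bounded_pos by blast
  then show ?thesis using that by auto
qed

text \<open>Gronwall's argument for the energy \<open>u ^ 2 + P ^ 2\<close>. It uses the flux
  \<open>P\<close> because \<open>v\<close> need not be differentiable; integrating factors of
  opposite sign treat the points to the right and to the left of \<open>z\<close>.\<close>

lemma double_zero:
  assumes sol: "solution F G u v w"
    and F: "continuous_on {T1..T2} F" and G: "continuous_on {T1..T2} G"
    and z: "z \<in> {T1..T2}" "u z = 0" "v z = 0" and t: "t \<in> {T1..T2}"
  shows "u t = 0"
proof -
  define P where "P t = p t * v t" for t
  define E where "E t = u t ^ 2 + P t ^ 2" for t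
  obtain Kp where Kp: "Kp > 0" "\<And>t. t \<in> {T1..T2} \<Longrightarrow> \<bar>1 / p t\<bar> \<le> Kp"
    by (rule continuous_bound[of "\<lambda>t. 1 / p t"])
      (use p_pos in \<open>force intro!: continuous_intros cont_p\<close>)+
  obtain Kq where Kq: "Kq > 0" "\<And>t. t \<in> {T1..T2} \<Longrightarrow> \<bar>q t\<bar> \<le> Kq"
    by (rule continuous_bound[OF cont_q]) blast
  obtain KF where KF: "KF > 0" "\<And>t. t \<in> {T1..T2} \<Longrightarrow> \<bar>F t\<bar> \<le> KF"
    by (rule continuous_bound[OF F]) blast
  obtain KG where KG: "KG > 0" "\<And>t. t \<in> {T1..T2} \<Longrightarrow> \<bar>G t\<bar> \<le> KG"
    by (rule continuous_bound[OF G]) blast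
  \<comment> \<open>\<open>\<bar>v\<bar> \<le> Kp * \<bar>P\<bar>\<close> and
    \<open>\<bar>w\<bar> \<le> (Kq + KF + KG) * \<bar>u\<bar>\<close>; since
    \<open>2 * \<bar>u\<bar> * \<bar>P\<bar> \<le> E\<close>, the sum of the two constants bounds
    the growth rate of \<open>E\<close>.\<close>
  define L where "L = Kp + (Kq + KF + KG)"
  note c = solution_continuous[OF sol]
  have cE: "continuous_on {T1..T2} E" unfolding E_def P_def by (intro continuous_intros c)
  have dE: "\<exists>e. (E has_real_derivative e) (at t) \<and> \<bar>e\<bar> \<le> L * E t" if "T1 < t" "t < T2" for t
  proof -
    have t: "t \<in> {T1..T2}" using that by auto
    have dP: "(P has_real_derivative w t) (at t)"
      using sol that by (auto simp: solution_def P_def[abs_def])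
    have d: "(E has_real_derivative 2 * u t * v t + 2 * P t * w t) (at t)"
      unfolding E_def by (rule derivative_eq_intros solution_deriv[OF sol that] dP refl)+ simp
    have "v t = P t * (1 / p t)" using p_pos[OF t] by (simp add: P_def)
    then have "\<bar>v t\<bar> \<le> \<bar>P t\<bar> * Kp"
      using Kp(2)[OF t] by (simp only: abs_mult mult_left_mono abs_ge_zero)
    moreover have "\<bar>w t\<bar> \<le> (Kq + KF + KG) * \<bar>u t\<bar>"
    proof -
      have "w t = q t * u t - (F t * max (u t) 0 - G t * max (- u t) 0)"
        using sol that by (auto simp: solution_def)
      moreover have "\<bar>q t * u t\<bar> \<le> Kq * \<bar>u t\<bar>"
        using Kq(2)[OF t] by (simp add: abs_mult mult_right_mono)
      moreover have "\<bar>F t * max (u t) 0\<bar> \<le> KF * \<bar>u t\<bar>"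
        unfolding abs_mult using KF(2)[OF t] KF(1) by (intro mult_mono) auto
      moreover have "\<bar>G t * max (- u t) 0\<bar> \<le> KG * \<bar>u t\<bar>"
        unfolding abs_mult using KG(2)[OF t] KG(1) by (intro mult_mono) auto
      ultimately show ?thesis unfolding distrib_right by linarith
    qed
    ultimately have "\<bar>u t\<bar> * \<bar>v t\<bar> + \<bar>P t\<bar> * \<bar>w t\<bar> \<le>
        \<bar>u t\<bar> * (\<bar>P t\<bar> * Kp) + \<bar>P t\<bar> * ((Kq + KF + KG) * \<bar>u t\<bar>)"
      by (intro add_mono mult_left_mono) auto
    also have "\<dots> = L * (\<bar>u t\<bar> * \<bar>P t\<bar>)" by (simp add: L_def algebra_simps)
    finally have "\<bar>2 * u t * v t + 2 * P t * w t\<bar> \<le> L * (2 * (\<bar>u t\<bar> * \<bar>P t\<bar>))"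
      by (intro order_trans[OF abs_triangle_ineq]) (simp add: abs_mult)
    also have "2 * (\<bar>u t\<bar> * \<bar>P t\<bar>) \<le> E t"
      unfolding E_def using sum_squares_bound[of "\<bar>u t\<bar>" "\<bar>P t\<bar>"] by simp
    finally show ?thesis using d Kp(1) Kq(1) KF(1) KG(1) by (auto simp: L_def mult_left_mono)
  qed
  have Ez: "E z = 0" using z by (simp add: E_def P_def)
  have "E t \<le> 0"
  proof (cases "z \<le> t")
    case True
    have "E t * exp (- L * t) \<le> E z * exp (- L * z)"
    proof (rule DERIV_nonpos_imp_decreasing_open[OF True])
      show "continuous_on {z..t} (\<lambda>s. E s * exp (- L * s))"
        by (intro continuous_intros continuous_on_subset[OF cE]) (use z t in auto)
      fix x assume "z < x" "x < t"
      then obtain e where e: "(E has_real_derivative e) (at x)" "\<bar>e\<bar> \<le> L * E x"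
        using dE[of x] z t by auto
      have "((\<lambda>s. E s * exp (- L * s)) has_real_derivative (e - L * E x) * exp (- L * x)) (at x)"
        by (auto intro!: derivative_eq_intros e simp: algebra_simps)
      moreover have "(e - L * E x) * exp (- L * x) \<le> 0" using e(2) by (simp add: mult_le_0_iff)
      ultimately show "\<exists>y. ((\<lambda>s. E s * exp (- L * s)) has_real_derivative y) (at x) \<and> y \<le> 0" by blast
    qed
    then show ?thesis using Ez by (simp add: mult_le_0_iff)
  next
    case False
    then have "t \<le> z" by simp
    then have "E t * exp (L * t) \<le> E z * exp (L * z)"
    proof (rule DERIV_nonneg_imp_increasing_open)
      show "continuous_on {t..z} (\<lambda>s. E s * exp (L * s))"
        by (intro continuous_intros continuous_on_subset[OF cE]) (use z t in auto)
      fix x assume "t < x" "x < z"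
      then obtain e where e: "(E has_real_derivative e) (at x)" "\<bar>e\<bar> \<le> L * E x"
        using dE[of x] z t by auto
      have "((\<lambda>s. E s * exp (L * s)) has_real_derivative (e + L * E x) * exp (L * x)) (at x)"
        by (auto intro!: derivative_eq_intros e simp: algebra_simps)
      moreover have "(e + L * E x) * exp (L * x) \<ge> 0" using e(2) by simp
      ultimately show "\<exists>y. ((\<lambda>s. E s * exp (L * s)) has_real_derivative y) (at x) \<and> y \<ge> 0" by blast
    qed
    then show ?thesis using Ez by (simp add: mult_le_0_iff)
  qed
  then have "u t ^ 2 \<le> 0" unfolding E_def using zero_le_power2[of "P t"] by linarith
  then show ?thesis by simp
qed

text \<open>Two kinds of nodal intervals occur. One starting at \<open>T1\<close> has slope zero
  there and must end in a zero of \<open>u\<close>, which \<open>u \<beta> > 0\<close> forbids. Any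
  other starts in a zero of \<open>u\<close>, where the mean value theorem yields a positive slope
  nearby that persists; it may end at \<open>T2\<close>, where only the slope vanishes, hence the
  extra conclusion \<open>v \<beta> > 0\<close>.\<close>

lemma flux_monotone:
  assumes sol: "solution F G u v w" and ab: "T1 \<le> \<alpha>" "\<alpha> < \<beta>" "\<beta> \<le> T2"
    and pos: "\<And>t. \<alpha> < t \<Longrightarrow> t < \<beta> \<Longrightarrow> u t > 0"
    and F: "\<And>t. \<alpha> < t \<Longrightarrow> t < \<beta> \<Longrightarrow> F t \<le> 0"
  shows "v \<alpha> = 0 \<Longrightarrow> u \<beta> > 0" and "u \<alpha> = 0 \<Longrightarrow> u \<beta> > 0 \<and> v \<beta> > 0"
proof -
  note c = solution_continuous[OF sol]
  have flux: "p s * v s \<le> p t * v t" if "\<alpha> \<le> s" "s \<le> t" "t \<le> \<beta>" for s t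
  proof (rule DERIV_nonneg_imp_increasing_open[OF that(2)])
    show "continuous_on {s..t} (\<lambda>t. p t * v t)"
      using that ab by (intro continuous_on_subset[OF c(2)]) auto
    fix x assume x: "s < x" "x < t"
    then have x': "x \<in> {T1<..<T2}" "u x > 0" "F x \<le> 0" using that ab pos F by auto
    have "w x = q x * u x - (F x * max (u x) 0 - G x * max (- u x) 0)"
      using sol x' by (simp add: solution_def)
    then have "w x = (q x - F x) * u x" using x' by (simp add: algebra_simps)
    then have "w x \<ge> 0" using x' q_nonneg[of x] by simp
    moreover have "((\<lambda>t. p t * v t) has_real_derivative w x) (at x)"
      using sol x' unfolding solution_def by blast
    ultimately show "\<exists>y. ((\<lambda>t. p t * v t) has_real_derivative y) (at x) \<and> 0 \<le> y" by blast
  qed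
  have incr: "u s \<le> u \<beta>" if s: "\<alpha> \<le> s" "s \<le> \<beta>" and v: "\<And>x. s < x \<Longrightarrow> x < \<beta> \<Longrightarrow> v x \<ge> 0" for s
  proof (rule DERIV_nonneg_imp_increasing_open[OF s(2)])
    show "continuous_on {s..\<beta>} u"
      using s ab by (intro continuous_on_subset[OF c(1)]) auto
    fix x assume x: "s < x" "x < \<beta>"
    then show "\<exists>y. (u has_real_derivative y) (at x) \<and> 0 \<le> y"
      using solution_deriv[OF sol, of x] v[of x] s ab by auto
  qed
  \<comment> \<open>Positivity of \<open>u\<close> is known only in the open interval, so strict
    inequalities at \<open>\<beta>\<close> come from comparison with an interior point.\<close>
  define s where "s = (\<alpha> + \<beta>) / 2"
  have s: "\<alpha> < s" "s < \<beta>" using ab by (auto simp: s_def)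
  show "u \<beta> > 0" if "v \<alpha> = 0"
  proof -
    have "v x \<ge> 0" if x: "\<alpha> < x" "x < \<beta>" for x
    proof -
      have "0 \<le> p x * v x" using flux[of \<alpha> x] \<open>v \<alpha> = 0\<close> x by simp
      then show ?thesis using p_pos[of x] x ab by (simp add: zero_le_mult_iff)
    qed
    then have "u s \<le> u \<beta>" using incr[of s] s by auto
    then show ?thesis using pos[OF s] by simp
  qed
  show "u \<beta> > 0 \<and> v \<beta> > 0" if "u \<alpha> = 0"
  proof -
    obtain x where x: "\<alpha> < x" "x < s" "u s - u \<alpha> = (s - \<alpha>) * v x"
    proof -
      have "\<exists>l z. \<alpha> < z \<and> z < s \<and> (u has_real_derivative l) (at z) \<and> u s - u \<alpha> = (s - \<alpha>) * l"
      proof (rule MVT[OF s(1)])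
        show "continuous_on {\<alpha>..s} u" by (rule continuous_on_subset[OF c(1)]) (use s ab in auto)
        show "u differentiable (at x)" if "\<alpha> < x" "x < s" for x
          using solution_deriv[OF sol, of x] that s ab real_differentiable_def by auto
      qed
      then obtain l z where z: "\<alpha> < z" "z < s" "(u has_real_derivative l) (at z)" "u s - u \<alpha> = (s - \<alpha>) * l"
        by blast
      have "l = v z" using DERIV_unique[OF z(3) solution_deriv[OF sol, of z]] z s ab by auto
      then show ?thesis using that z by blast
    qed
    have "(s - \<alpha>) * v x > 0" using x(3) \<open>u \<alpha> = 0\<close> pos[OF s] by simp
    then have vx: "v x > 0" using s(1) by (simp add: zero_less_mult_iff)
    have vy: "v y > 0" if y: "x \<le> y" "y \<le> \<beta>" for y
    proof -
      have "0 < p x * v x" using vx p_pos[of x] x s ab by simp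
      also have "\<dots> \<le> p y * v y" using flux[of x y] x y by simp
      finally show ?thesis using p_pos[of y] x y ab by (simp add: zero_less_mult_iff)
    qed
    have "u x \<le> u \<beta>" using incr[of x] x s vy by (auto intro: less_imp_le)
    then show ?thesis using pos[of x] x s vy[of \<beta>] by simp
  qed
qed

lemma pos_if_no_zero:
  fixes u :: "real \<Rightarrow> real"
  assumes "continuous_on {t..s} u" "t \<le> s" "u s > 0" "\<And>x. t \<le> x \<Longrightarrow> x \<le> s \<Longrightarrow> u x \<noteq> 0"
  shows "u t > 0"
proof (rule ccontr)
  assume "\<not> u t > 0"
  then obtain x where "t \<le> x" "x \<le> s" "u x = 0" using IVT'[of u t 0 s] assms by auto
  then show False using assms by blast
qed

text \<open>Induction from the right: the last nodal interval supplies the last point of the chain,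
  and the rest is treated with \<open>- u\<close> and with \<open>F\<close> and \<open>G\<close>
  exchanged. At the outset \<open>z\<close> is \<open>T2\<close>, where only the slope vanishes.
  This alternative demands \<open>k \<ge> 1\<close>, because a positive constant is a solution
  without zeros when \<open>q\<close> and \<open>F\<close> vanish.\<close>

lemma nodal_alt_chain:
  assumes "solution F G u v w" "v T1 = 0"
    and "\<And>t. t \<in> {T1..T2} \<Longrightarrow> u t = 0 \<Longrightarrow> v t \<noteq> 0"
    and "T1 < z" "z \<le> T2" "u z = 0 \<or> (v z = 0 \<and> k \<ge> 1)"
    and "finite {t \<in> {T1<..<z}. u t = 0}" "card {t \<in> {T1<..<z}. u t = 0} = k"
    and "\<exists>y\<in>{T1..<z}. \<forall>t\<in>{y<..<z}. u t > 0"
  shows "alt_chain (signed_above T1 1 F) (signed_above T1 1 G) (Suc k) z"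
  using assms
proof (induction k arbitrary: F G u v w z)
  case 0
  note sol = \<open>solution F G u v w\<close>
  have nz: "u t \<noteq> 0" if "T1 < t" "t < z" for t using 0 that by auto
  obtain y where y: "T1 \<le> y" "y < z" "\<And>t. y < t \<Longrightarrow> t < z \<Longrightarrow> u t > 0" using "0.prems"(9) by auto
  have pos: "u t > 0" if t: "T1 < t" "t < z" for t
  proof -
    obtain s where s: "max t y < s" "s < z" using dense[of "max t y" z] t y by auto
    show ?thesis
      by (rule pos_if_no_zero[of t s]; (rule continuous_on_subset[OF solution_continuous(1)[OF sol]])?)
        (use s t y nz "0.prems" in auto)
  qed
  have "\<exists>t>T1. t < z \<and> F t > 0"
  proof (rule ccontr)
    assume "\<not> ?thesis"
    then have "u z > 0" using flux_monotone(1)[OF sol order_refl, of z] "0.prems" pos by force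
    then show False using "0.prems" by auto
  qed
  then show ?case by (auto simp: signed_above_def)
next
  case (Suc k)
  note sol = \<open>solution F G u v w\<close>
  let ?Z = "{t \<in> {T1<..<z}. u t = 0}"
  have Z: "finite ?Z" "?Z \<noteq> {}" using Suc.prems(7,8) by (blast, metis card.empty nat.distinct(1))
  define z' where "z' = Max ?Z"
  have "z' \<in> ?Z" using Z unfolding z'_def by (rule Max_in)
  then have z': "T1 < z'" "z' < z" "u z' = 0" by auto
  have nz: "u t \<noteq> 0" if "z' < t" "t < z" for t
  proof
    assume "u t = 0"
    then have "t \<in> ?Z" using that z' by auto
    then show False using Max_ge[OF Z(1)] that by (force simp: z'_def)
  qed
  obtain y where y: "T1 \<le> y" "y < z" "\<And>t. y < t \<Longrightarrow> t < z \<Longrightarrow> u t > 0" using Suc.prems(9) by auto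
  have pos: "u t > 0" if t: "z' < t" "t < z" for t
  proof -
    obtain s where s: "max t y < s" "s < z" using dense[of "max t y" z] t y by auto
    show ?thesis
      by (rule pos_if_no_zero[of t s]; (rule continuous_on_subset[OF solution_continuous(1)[OF sol]])?)
        (use s t y z' nz Suc.prems in auto)
  qed
  have "\<exists>t>z'. t < z \<and> F t > 0"
  proof (rule ccontr)
    assume "\<not> ?thesis"
    then have "u z > 0 \<and> v z > 0"
      using flux_monotone(2)[OF sol, of z' z] Suc.prems z' pos by force
    then show False using Suc.prems by auto
  qed
  then obtain t where t: "z' < t" "t < z" "F t > 0" by blast
  have du: "(u has_real_derivative v z') (at z')"
    using solution_deriv[OF sol] z' Suc.prems by auto
  \<comment> \<open>Positivity to the right of \<open>z'\<close> excludes a negative slope and the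
    absence of double zeros excludes slope zero. Hence \<open>u\<close> is negative just to the
    left, as the induction hypothesis for \<open>- u\<close> requires.\<close>
  have "v z' > 0"
  proof (rule ccontr)
    assume "\<not> v z' > 0"
    moreover have "v z' \<noteq> 0" using Suc.prems(3)[of z'] z' Suc.prems(5) by simp
    ultimately have "v z' < 0" by simp
    from has_real_derivative_neg_dec_right[OF du this] obtain d where
      d: "d > 0" "\<And>h. h > 0 \<Longrightarrow> h < d \<Longrightarrow> u (z' + h) < u z'" by auto
    obtain h where "0 < h" "h < min d (z - z')" using dense[of 0 "min d (z - z')"] d z' by auto
    then show False using d(2)[of h] pos[of "z' + h"] z' by auto
  qed
  from has_real_derivative_pos_inc_left[OF du this] obtain d where
    d: "d > 0" "\<And>h. h > 0 \<Longrightarrow> h < d \<Longrightarrow> u (z' - h) < u z'" by auto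
  have Z': "?Z = insert z' {t \<in> {T1<..<z'}. u t = 0}"
  proof (intro set_eqI iffI)
    fix t assume "t \<in> ?Z"
    then show "t \<in> insert z' {t \<in> {T1<..<z'}. u t = 0}" using nz[of t] by (cases t z' rule: linorder_cases) auto
  qed (use z' in auto)
  have fin': "finite {t \<in> {T1<..<z'}. u t = 0}" using Z(1) Z' by auto
  have "Suc k = Suc (card {t \<in> {T1<..<z'}. u t = 0})"
    using Suc.prems(8) Z' fin' by (simp add: card_insert_if)
  then have card': "card {t \<in> {T1<..<z'}. u t = 0} = k" by simp
  have "alt_chain (signed_above T1 1 G) (signed_above T1 1 F) (Suc k) z'"
  proof (rule Suc.IH[OF solution_minus[OF sol]])
    show "\<exists>y\<in>{T1..<z'}. \<forall>t\<in>{y<..<z'}. 0 < - u t"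
    proof (intro bexI ballI)
      fix t assume "t \<in> {max T1 (z' - d)<..<z'}"
      then show "0 < - u t" using d(2)[of "z' - t"] z' by auto
    qed (use d z' in auto)
  qed (use Suc.prems z' fin' card' in auto)
  then have "alt_chain (signed_above T1 1 G) (signed_above T1 1 F) (Suc k) t"
    using alt_chain_mono t by (meson less_imp_le)
  moreover have "signed_above T1 1 F t" using t z' by (simp add: signed_above_def)
  ultimately show ?case using t(2) alt_chain.simps(2) by blast
qed

end


section \<open>Scalar differential equations with a Lipschitz right-hand side\<close>

text \<open>Banach's fixed point theorem in Bielecki's weighted norm: the unknown is the solution
  times \<open>exp (- l * t)\<close>, and \<open>l = 2 * L\<close> turns the integral operator into
  a contraction with factor \<open>1 / 2\<close> on the whole interval at once.\<close>

lemma scalar_ode_exists: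
  fixes H :: "real \<Rightarrow> real \<Rightarrow> real"
  assumes ab: "a < b"
    and cont: "continuous_on ({a..b} \<times> UNIV) (\<lambda>(t, x). H t x)"
    and L: "L > 0" "\<And>t x y. t \<in> {a..b} \<Longrightarrow> \<bar>H t x - H t y\<bar> \<le> L * \<bar>x - y\<bar>"
  shows "\<exists>\<theta>. \<theta> a = x0 \<and> (\<forall>t\<in>{a..b}. (\<theta> has_real_derivative H t (\<theta> t)) (at t within {a..b}))"
proof -
  define l where "l = 2 * L"
  have l: "l > 0" using L by (simp add: l_def)
  have contH: "continuous_on {a..b} (\<lambda>s. H s (z s))" if "continuous_on {a..b} z" for z
  proof -
    have "continuous_on {a..b} (\<lambda>s. (s, z s))" using that by (intro continuous_intros)
    then have "continuous_on {a..b} (\<lambda>s. (\<lambda>(t, x). H t x) (s, z s))"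
      by (rule continuous_on_compose2[OF cont]) auto
    then show ?thesis by simp
  qed
  define I where "I y t = x0 + integral {a..t} (\<lambda>s. H s (exp (l * s) * apply_bcontfun y s))"
    for y :: "real \<Rightarrow>\<^sub>C real" and t
  define J where "J y t = exp (- l * t) * I y t" for y t
  \<comment> \<open>Clamping the argument extends functions on \<open>{a..b}\<close> to bounded
    continuous functions on the line, which form a complete space.\<close>
  define c where "c t = max a (min b t)" for t
  have c: "c t \<in> {a..b}" for t using ab by (auto simp: c_def)
  have cont_c: "continuous_on UNIV c" unfolding c_def[abs_def] by (intro continuous_intros)
  have contG: "continuous_on {a..b} (\<lambda>s. H s (exp (l * s) * apply_bcontfun y s))" for y
    by (intro contH continuous_intros) auto
  have derivI: "(I y has_real_derivative H t (exp (l * t) * apply_bcontfun y t)) (at t within {a..b})"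
    if "t \<in> {a..b}" for y t
    unfolding I_def using integral_has_real_derivative[OF contG that, of y]
    by (auto intro!: derivative_eq_intros)
  have contJ: "continuous_on {a..b} (J y)" for y
    unfolding J_def[abs_def] by (intro continuous_intros DERIV_continuous_on[OF derivI]) auto
  have Jc: "(\<lambda>t. J y (c t)) \<in> bcontfun" for y
  proof -
    have "compact (J y ` {a..b})" using contJ by (intro compact_continuous_image) auto
    then obtain K where K: "\<forall>x\<in>J y ` {a..b}. norm x \<le> K"
      using compact_imp_bounded bounded_iff by blast
    show ?thesis
    proof (rule bcontfun_normI)
      show "continuous_on UNIV (\<lambda>t. J y (c t))"
        by (rule continuous_on_compose2[OF contJ cont_c]) (use c in auto)
      show "norm (J y (c t)) \<le> K" for t using c K by auto
    qed
  qed
  define \<Phi> where "\<Phi> y = Bcontfun (\<lambda>t. J y (c t))" for y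
  have \<Phi>: "apply_bcontfun (\<Phi> y) t = J y (c t)" for y t
    unfolding \<Phi>_def using Bcontfun_inverse[OF Jc] by simp
  have contr: "dist (\<Phi> y) (\<Phi> z) \<le> (1 / 2) * dist y z" for y z
  proof (rule dist_bound)
    fix t
    define d where "d = dist y z"
    define \<tau> where "\<tau> = c t"
    have \<tau>: "a \<le> \<tau>" "\<tau> \<le> b" using c[of t] by (auto simp: \<tau>_def)
    have "((\<lambda>s. exp (l * s)) has_integral (exp (l * \<tau>) / l - exp (l * a) / l)) {a..\<tau>}"
      by (rule fundamental_theorem_of_calculus[OF \<tau>(1)])
        (use l in \<open>auto intro!: derivative_eq_intros simp: has_real_derivative_iff_has_vector_derivative[symmetric]\<close>)
    then have hi: "((\<lambda>s. L * d * exp (l * s)) has_integral (L * d * (exp (l * \<tau>) / l - exp (l * a) / l))) {a..\<tau>}"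
      by (rule has_integral_mult_right)
    have int: "(\<lambda>s. H s (exp (l * s) * apply_bcontfun x s)) integrable_on {a..\<tau>}" for x
      by (rule integrable_continuous_real[OF continuous_on_subset[OF contG]]) (use \<tau> in auto)
    have "\<bar>I y \<tau> - I z \<tau>\<bar> = \<bar>integral {a..\<tau>} (\<lambda>s. H s (exp (l * s) * apply_bcontfun y s) - H s (exp (l * s) * apply_bcontfun z s))\<bar>"
      unfolding I_def by (simp add: integral_diff[OF int int])
    also have "\<dots> \<le> integral {a..\<tau>} (\<lambda>s. L * d * exp (l * s))"
      unfolding real_norm_def[symmetric]
    proof (rule integral_norm_bound_integral)
      fix s assume s: "s \<in> {a..\<tau>}"
      have "\<bar>H s (exp (l * s) * apply_bcontfun y s) - H s (exp (l * s) * apply_bcontfun z s)\<bar>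
          \<le> L * \<bar>exp (l * s) * apply_bcontfun y s - exp (l * s) * apply_bcontfun z s\<bar>"
        using s \<tau> by (intro L(2)) auto
      also have "\<dots> = L * exp (l * s) * dist (apply_bcontfun y s) (apply_bcontfun z s)"
        by (simp add: dist_real_def abs_mult flip: right_diff_distrib)
      also have "\<dots> \<le> L * exp (l * s) * d"
        unfolding d_def using L(1) by (intro mult_left_mono dist_bounded) auto
      finally show "norm (H s (exp (l * s) * apply_bcontfun y s) - H s (exp (l * s) * apply_bcontfun z s))
          \<le> L * d * exp (l * s)" by (simp add: mult_ac)
    qed (auto intro!: integrable_diff int has_integral_integrable[OF hi])
    also have "\<dots> = d / 2 * (exp (l * \<tau>) - exp (l * a))"
      unfolding integral_unique[OF hi] using L(1) by (simp add: l_def field_simps)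
    also have "\<dots> \<le> d / 2 * exp (l * \<tau>)"
      unfolding d_def by (intro mult_left_mono) auto
    finally have "\<bar>I y \<tau> - I z \<tau>\<bar> \<le> d / 2 * exp (l * \<tau>)" .
    then have "exp (- l * \<tau>) * \<bar>I y \<tau> - I z \<tau>\<bar> \<le> exp (- l * \<tau>) * (d / 2 * exp (l * \<tau>))"
      by (intro mult_left_mono) auto
    also have "\<dots> = d / 2" by (simp add: exp_minus field_simps)
    finally show "dist (apply_bcontfun (\<Phi> y) t) (apply_bcontfun (\<Phi> z) t) \<le> (1 / 2) * dist y z"
      unfolding \<Phi> \<tau>_def[symmetric] J_def d_def[symmetric]
      by (simp add: dist_real_def abs_mult flip: right_diff_distrib)
  qed
  have "\<exists>!y. \<Phi> y = y"
    by (rule banach_fix_type[where c = "1 / 2"]) (use contr in auto)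
  then obtain y where y: "\<Phi> y = y" by auto
  have Iy: "exp (l * t) * apply_bcontfun y t = I y t" if "t \<in> {a..b}" for t
  proof -
    have "apply_bcontfun y t = J y (c t)" using \<Phi>[of y t] y by simp
    also have "c t = t" using that by (auto simp: c_def)
    finally show ?thesis by (simp add: J_def exp_minus field_simps)
  qed
  show ?thesis
  proof (intro exI conjI ballI)
    show "I y a = x0" by (simp add: I_def)
    fix t assume "t \<in> {a..b}"
    then show "(I y has_real_derivative H t (I y t)) (at t within {a..b})"
      using derivI[of t y] Iy[of t] by simp
  qed
qed

text \<open>Gronwall's argument for the square of \<open>d\<close>, as \<open>\<bar>d\<bar>\<close>
  need not be differentiable. Absorbing the mixed term by
  \<open>2 * \<bar>d\<bar> * \<epsilon> \<le> d^2 + \<epsilon>^2\<close> costs the \<open>1\<close>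
  in \<open>2 * L + 1\<close>. The bound is linear in \<open>\<epsilon>\<close>, which later gives
  Lipschitz dependence on the parameter.\<close>

lemma differential_inequality:
  fixes d e :: "real \<Rightarrow> real"
  assumes ab: "a \<le> b" and d: "\<And>t. t \<in> {a..b} \<Longrightarrow> (d has_real_derivative e t) (at t within {a..b})"
    and e: "\<And>t. t \<in> {a..b} \<Longrightarrow> \<bar>e t\<bar> \<le> L * \<bar>d t\<bar> + \<epsilon>" and "d a = 0" "\<epsilon> \<ge> 0"  "L \<ge> 0"
  shows "\<bar>d b\<bar> \<le> \<epsilon> * sqrt ((b - a) * exp ((2 * L + 1) * (b - a)))"
proof -
  define M where "M = 2 * L + 1"
  let ?f = "\<lambda>t. (d t)^2 * exp (- M * (t - a)) - \<epsilon>^2 * (t - a)"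
  have "?f b \<le> ?f a"
  proof (rule DERIV_nonpos_imp_decreasing_open[OF ab])
    show "continuous_on {a..b} ?f"
      by (intro continuous_intros DERIV_continuous_on[OF d])
    fix t assume t: "a < t" "t < b"
    have dt: "(d has_real_derivative e t) (at t)"
      using d[of t] t at_within_Icc_at[of a t b] by auto
    let ?y = "(2 * d t * e t - M * (d t)^2) * exp (- M * (t - a)) - \<epsilon>^2"
    have "(?f has_real_derivative ?y) (at t)"
      by (auto intro!: derivative_eq_intros dt simp: algebra_simps power2_eq_square)
    moreover have "?y \<le> 0"
    proof -
      have "2 * d t * e t \<le> 2 * (\<bar>d t\<bar> * \<bar>e t\<bar>)"
        using abs_ge_self[of "d t * e t"] by (simp add: abs_mult)
      also have "\<dots> \<le> 2 * (\<bar>d t\<bar> * (L * \<bar>d t\<bar> + \<epsilon>))"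
        using e[of t] t by (intro mult_left_mono) auto
      also have "\<dots> = 2 * L * (d t)^2 + 2 * \<bar>d t\<bar> * \<epsilon>"
        by (simp add: algebra_simps power2_eq_square)
      also have "2 * \<bar>d t\<bar> * \<epsilon> \<le> (d t)^2 + \<epsilon>^2"
        using sum_squares_bound[of "\<bar>d t\<bar>" \<epsilon>] by simp
      finally have "2 * d t * e t - M * (d t)^2 \<le> \<epsilon>^2" by (simp add: M_def algebra_simps)
      moreover have "M * (t - a) \<ge> 0" using t \<open>L \<ge> 0\<close> by (simp add: M_def)
      then have "exp (- M * (t - a)) \<le> 1" by simp
      ultimately have "(2 * d t * e t - M * (d t)^2) * exp (- M * (t - a)) \<le> \<epsilon>^2 * 1"
        by (meson exp_ge_zero mult_left_mono mult_right_mono order_trans zero_le_power2)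
      then show ?thesis by simp
    qed
    ultimately show "\<exists>y. (?f has_real_derivative y) (at t) \<and> y \<le> 0" by blast
  qed
  then have "(d b)^2 * exp (- M * (b - a)) \<le> \<epsilon>^2 * (b - a)" using \<open>d a = 0\<close> by simp
  then have "(d b)^2 * exp (- M * (b - a)) * exp (M * (b - a)) \<le> \<epsilon>^2 * (b - a) * exp (M * (b - a))"
    by (intro mult_right_mono) auto
  then have "(d b)^2 \<le> \<epsilon>^2 * ((b - a) * exp (M * (b - a)))"
    by (simp add: mult.assoc flip: exp_add)
  then have "sqrt ((d b)^2) \<le> sqrt (\<epsilon>^2 * ((b - a) * exp (M * (b - a))))"
    by (rule real_sqrt_le_mono)
  then show ?thesis using \<open>\<epsilon> \<ge> 0\<close> by (simp add: real_sqrt_mult M_def)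
qed

section \<open>Pruefer angles\<close>

context sturm
begin

text \<open>The convention is \<open>u = r * cos \<theta>\<close> and
  \<open>p * u' = - r * sin \<theta>\<close>: zeros of \<open>u\<close> are zeros of the cosine, and
  the Neumann condition says that the sine vanishes.\<close>

definition pruefer :: "(real \<Rightarrow> real) \<Rightarrow> (real \<Rightarrow> real) \<Rightarrow> real \<Rightarrow> real \<Rightarrow> real" where
  "pruefer F G t x = (sin x)\<^sup>2 / p t + F t * (max (cos x) 0)\<^sup>2 + G t * (max (- cos x) 0)\<^sup>2 - q t * (cos x)\<^sup>2"

definition angle :: "(real \<Rightarrow> real) \<Rightarrow> (real \<Rightarrow> real) \<Rightarrow> (real \<Rightarrow> real) \<Rightarrow> bool" where
  "angle F G \<theta> \<longleftrightarrow> (\<forall>t\<in>{T1..T2}. (\<theta> has_real_derivative pruefer F G t (\<theta> t)) (at t within {T1..T2}))"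

section \<open>Existence of angles and dependence on the parameter\<close>

lemma square_lipschitz:
  fixes A B :: real
  assumes "\<bar>A\<bar> \<le> 1" "\<bar>B\<bar> \<le> 1" "\<bar>A - B\<bar> \<le> d"
  shows "\<bar>A\<^sup>2 - B\<^sup>2\<bar> \<le> 2 * d"
proof -
  have "\<bar>A\<^sup>2 - B\<^sup>2\<bar> = \<bar>A + B\<bar> * \<bar>A - B\<bar>" by (simp add: square_diff_square_factored power2_eq_square abs_mult)
  also have "\<dots> \<le> 2 * d" using assms by (intro mult_mono) auto
  finally show ?thesis .
qed

lemma sin_lipschitz: "\<bar>sin x - sin y\<bar> \<le> \<bar>x - y :: real\<bar>"
  and cos_lipschitz: "\<bar>cos x - cos y\<bar> \<le> \<bar>x - y :: real\<bar>"
proof -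
  have *: "norm (f x - f y) \<le> 1 * norm (x - y)"
    if "\<And>z. (f has_real_derivative f' z) (at z within UNIV)" "\<And>z. norm (f' z) \<le> 1" for f f' :: "real \<Rightarrow> real"
    by (rule field_differentiable_bound[OF convex_UNIV that]) auto
  show "\<bar>sin x - sin y\<bar> \<le> \<bar>x - y\<bar>"
    using *[of sin cos] by (auto intro: derivative_intros)
  show "\<bar>cos x - cos y\<bar> \<le> \<bar>x - y\<bar>"
    using *[of cos "\<lambda>z. - sin z"] by (auto intro: derivative_intros)
qed

lemma pruefer_lipschitz:
  assumes "\<bar>1 / p t\<bar> \<le> Kp" "\<bar>F t\<bar> \<le> KF" "\<bar>G t\<bar> \<le> KG" "\<bar>q t\<bar> \<le> Kq"
  shows "\<bar>pruefer F G t x - pruefer F G t y\<bar> \<le> 2 * (Kp + KF + KG + Kq) * \<bar>x - y\<bar>"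
proof -
  have s: "\<bar>(sin x)\<^sup>2 - (sin y)\<^sup>2\<bar> \<le> 2 * \<bar>x - y\<bar>"
    by (intro square_lipschitz sin_lipschitz) auto
  have c: "\<bar>(cos x)\<^sup>2 - (cos y)\<^sup>2\<bar> \<le> 2 * \<bar>x - y\<bar>"
    by (intro square_lipschitz cos_lipschitz) auto
  have cp: "\<bar>(max (cos x) 0)\<^sup>2 - (max (cos y) 0)\<^sup>2\<bar> \<le> 2 * \<bar>x - y\<bar>"
    using abs_cos_le_one[of x] abs_cos_le_one[of y] cos_lipschitz[of x y]
    by (intro square_lipschitz) (auto simp: max_def abs_if)
  have cm: "\<bar>(max (- cos x) 0)\<^sup>2 - (max (- cos y) 0)\<^sup>2\<bar> \<le> 2 * \<bar>x - y\<bar>"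
    using abs_cos_le_one[of x] abs_cos_le_one[of y] cos_lipschitz[of x y]
    by (intro square_lipschitz) (auto simp: max_def abs_if)
  have m: "\<bar>A * B\<bar> \<le> K * (2 * \<bar>x - y\<bar>)" if "\<bar>A\<bar> \<le> K" "\<bar>B\<bar> \<le> 2 * \<bar>x - y\<bar>" for A B K
    unfolding abs_mult using that by (intro mult_mono) auto
  note ms = m[OF assms(1) s] m[OF assms(2) cp] m[OF assms(3) cm] m[OF assms(4) c]
  have "pruefer F G t x - pruefer F G t y = 1 / p t * ((sin x)\<^sup>2 - (sin y)\<^sup>2)
      + F t * ((max (cos x) 0)\<^sup>2 - (max (cos y) 0)\<^sup>2) + G t * ((max (- cos x) 0)\<^sup>2 - (max (- cos y) 0)\<^sup>2)
      - q t * ((cos x)\<^sup>2 - (cos y)\<^sup>2)"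
    by (simp add: pruefer_def algebra_simps diff_divide_distrib)
  then have "\<bar>pruefer F G t x - pruefer F G t y\<bar> \<le> \<bar>1 / p t * ((sin x)\<^sup>2 - (sin y)\<^sup>2)\<bar>
      + \<bar>F t * ((max (cos x) 0)\<^sup>2 - (max (cos y) 0)\<^sup>2)\<bar> + \<bar>G t * ((max (- cos x) 0)\<^sup>2 - (max (- cos y) 0)\<^sup>2)\<bar>
      + \<bar>q t * ((cos x)\<^sup>2 - (cos y)\<^sup>2)\<bar>" by linarith
  also have "\<dots> \<le> Kp * (2 * \<bar>x - y\<bar>) + KF * (2 * \<bar>x - y\<bar>) + KG * (2 * \<bar>x - y\<bar>) + Kq * (2 * \<bar>x - y\<bar>)"
    by (rule add_mono[OF add_mono[OF add_mono[OF ms(1,2)] ms(3)] ms(4)])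
  finally show ?thesis by (simp add: algebra_simps)
qed

lemma continuous_pruefer:
  assumes "continuous_on {T1..T2} F" "continuous_on {T1..T2} G"
  shows "continuous_on ({T1..T2} \<times> UNIV) (\<lambda>(t, x). pruefer F G t x)"
proof -
  have *: "continuous_on ({T1..T2} \<times> UNIV) (\<lambda>z :: real \<times> real. h (fst z))" if "continuous_on {T1..T2} h"
    for h :: "real \<Rightarrow> real"
    by (rule continuous_on_compose2[OF that]) (auto intro: continuous_intros)
  have "p (fst z) \<noteq> 0" if "z \<in> {T1..T2} \<times> (UNIV :: real set)" for z
    using that p_pos[of "fst z"] by auto
  then show ?thesis unfolding pruefer_def split_def
    by (intro continuous_intros * assms cont_p cont_q) auto
qed

lemma inverse_p_bound:
  obtains K where "K > 0" "\<And>t. t \<in> {T1..T2} \<Longrightarrow> \<bar>1 / p t\<bar> \<le> K"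
  by (rule continuous_bound[of "\<lambda>t. 1 / p t"])
    (use p_pos in \<open>force intro!: continuous_intros cont_p\<close>)+

lemma angle_exists:
  assumes F: "continuous_on {T1..T2} F" and G: "continuous_on {T1..T2} G"
  shows "\<exists>\<theta>. angle F G \<theta> \<and> \<theta> T1 = x0"
proof -
  obtain Kp where Kp: "Kp > 0" "\<And>t. t \<in> {T1..T2} \<Longrightarrow> \<bar>1 / p t\<bar> \<le> Kp" using inverse_p_bound by blast
  obtain Kq where Kq: "Kq > 0" "\<And>t. t \<in> {T1..T2} \<Longrightarrow> \<bar>q t\<bar> \<le> Kq"
    by (rule continuous_bound[OF cont_q]) blast
  obtain KF where KF: "KF > 0" "\<And>t. t \<in> {T1..T2} \<Longrightarrow> \<bar>F t\<bar> \<le> KF"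
    by (rule continuous_bound[OF F]) blast
  obtain KG where KG: "KG > 0" "\<And>t. t \<in> {T1..T2} \<Longrightarrow> \<bar>G t\<bar> \<le> KG"
    by (rule continuous_bound[OF G]) blast
  have "2 * (Kp + KF + KG + Kq) > 0" using Kp Kq KF KG by simp
  from scalar_ode_exists[OF T1_less_T2 continuous_pruefer[OF F G] this pruefer_lipschitz, of x0]
  show ?thesis using Kp Kq KF KG unfolding angle_def by blast
qed

text \<open>The difference of the speeds is split in two: changing the angle at fixed
  \<open>c\<close> costs \<open>L * \<bar>\<theta> - \<phi>\<bar>\<close>, and changing
  \<open>c\<close> at a fixed angle costs a multiple of \<open>\<bar>c - c'\<bar>\<close>, since
  \<open>pruefer\<close> is affine in the weights. \<open>K\<close> depends on the bound
  \<open>C\<close> only.\<close>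

lemma angle_dependence:
  assumes f: "continuous_on {T1..T2} f" and g: "continuous_on {T1..T2} g"
  obtains K where "\<And>c c' \<theta> \<phi>. \<lbrakk>\<bar>c\<bar> \<le> C; angle (\<lambda>t. c * f t) (\<lambda>t. c * g t) \<theta>;
    angle (\<lambda>t. c' * f t) (\<lambda>t. c' * g t) \<phi>; \<theta> T1 = \<phi> T1\<rbrakk> \<Longrightarrow> \<bar>\<theta> T2 - \<phi> T2\<bar> \<le> K * \<bar>c - c'\<bar>"
proof -
  obtain Kp where Kp: "Kp > 0" "\<And>t. t \<in> {T1..T2} \<Longrightarrow> \<bar>1 / p t\<bar> \<le> Kp" using inverse_p_bound by blast
  obtain Kq where Kq: "Kq > 0" "\<And>t. t \<in> {T1..T2} \<Longrightarrow> \<bar>q t\<bar> \<le> Kq"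
    by (rule continuous_bound[OF cont_q]) blast
  obtain Kf where Kf: "Kf > 0" "\<And>t. t \<in> {T1..T2} \<Longrightarrow> \<bar>f t\<bar> \<le> Kf"
    by (rule continuous_bound[OF f]) blast
  obtain Kg where Kg: "Kg > 0" "\<And>t. t \<in> {T1..T2} \<Longrightarrow> \<bar>g t\<bar> \<le> Kg"
    by (rule continuous_bound[OF g]) blast
  define L where "L = 2 * (Kp + \<bar>C\<bar> * Kf + \<bar>C\<bar> * Kg + Kq)"
  have L: "L \<ge> 0" using Kp Kq Kf Kg by (simp add: L_def)
  show thesis
  proof (rule that)
    fix c c' \<theta> \<phi>
    assume c: "\<bar>c\<bar> \<le> C" and \<theta>: "angle (\<lambda>t. c * f t) (\<lambda>t. c * g t) \<theta>"
      and \<phi>: "angle (\<lambda>t. c' * f t) (\<lambda>t. c' * g t) \<phi>" and eq: "\<theta> T1 = \<phi> T1"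
    have "\<bar>\<theta> T2 - \<phi> T2\<bar> \<le> (\<bar>c - c'\<bar> * (Kf + Kg)) * sqrt ((T2 - T1) * exp ((2 * L + 1) * (T2 - T1)))"
    proof (rule differential_inequality[where d = "\<lambda>t. \<theta> t - \<phi> t"])
      fix t assume t: "t \<in> {T1..T2}"
      show "((\<lambda>t. \<theta> t - \<phi> t) has_real_derivative
          pruefer (\<lambda>t. c * f t) (\<lambda>t. c * g t) t (\<theta> t) - pruefer (\<lambda>t. c' * f t) (\<lambda>t. c' * g t) t (\<phi> t))
          (at t within {T1..T2})"
        using \<theta> \<phi> t by (auto simp: angle_def intro!: DERIV_diff)
      have "\<bar>c * f t\<bar> \<le> \<bar>C\<bar> * Kf" "\<bar>c * g t\<bar> \<le> \<bar>C\<bar> * Kg"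
        unfolding abs_mult using c Kf(2)[OF t] Kg(2)[OF t] by (auto intro!: mult_mono)
      then have 1: "\<bar>pruefer (\<lambda>t. c * f t) (\<lambda>t. c * g t) t (\<theta> t) - pruefer (\<lambda>t. c * f t) (\<lambda>t. c * g t) t (\<phi> t)\<bar>
          \<le> L * \<bar>\<theta> t - \<phi> t\<bar>"
        unfolding L_def by (intro pruefer_lipschitz Kp(2) Kq(2) t)
      have sq: "(max (cos x) 0)\<^sup>2 \<le> 1" "(max (- cos x) 0)\<^sup>2 \<le> 1" for x :: real
        using cos_le_one[of x] cos_ge_minus_one[of x] by (intro power_le_one; simp)+
      have "\<bar>f t * (max (cos (\<phi> t)) 0)\<^sup>2 + g t * (max (- cos (\<phi> t)) 0)\<^sup>2\<bar> \<le> Kf * 1 + Kg * 1"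
        by (intro order_trans[OF abs_triangle_ineq] add_mono; unfold abs_mult; intro mult_mono)
          (use Kf Kg t sq in \<open>auto intro: less_imp_le\<close>)
      moreover have "pruefer (\<lambda>t. c * f t) (\<lambda>t. c * g t) t (\<phi> t) - pruefer (\<lambda>t. c' * f t) (\<lambda>t. c' * g t) t (\<phi> t)
          = (c - c') * (f t * (max (cos (\<phi> t)) 0)\<^sup>2 + g t * (max (- cos (\<phi> t)) 0)\<^sup>2)"
        by (simp add: pruefer_def algebra_simps)
      ultimately have "\<bar>pruefer (\<lambda>t. c * f t) (\<lambda>t. c * g t) t (\<phi> t) - pruefer (\<lambda>t. c' * f t) (\<lambda>t. c' * g t) t (\<phi> t)\<bar>
          \<le> \<bar>c - c'\<bar> * (Kf + Kg)"
        by (simp add: abs_mult mult_left_mono)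
      with 1 show "\<bar>pruefer (\<lambda>t. c * f t) (\<lambda>t. c * g t) t (\<theta> t) - pruefer (\<lambda>t. c' * f t) (\<lambda>t. c' * g t) t (\<phi> t)\<bar>
          \<le> L * \<bar>\<theta> t - \<phi> t\<bar> + \<bar>c - c'\<bar> * (Kf + Kg)" by linarith
    qed (use T1_less_T2 eq L Kf Kg in auto)
    then show "\<bar>\<theta> T2 - \<phi> T2\<bar> \<le> ((Kf + Kg) * sqrt ((T2 - T1) * exp ((2 * L + 1) * (T2 - T1)))) * \<bar>c - c'\<bar>"
      by (simp add: mult_ac)
  qed
qed

text \<open>Half a turn of the angle corresponds to passing from \<open>u\<close> to
  \<open>- u\<close>.\<close>

lemma angle_shift:
  assumes "angle F G \<theta>"
  shows "angle G F (\<lambda>t. \<theta> t + pi)"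
proof -
  have "pruefer G F t (x + pi) = pruefer F G t x" for t x by (simp add: pruefer_def)
  then show ?thesis using assms unfolding angle_def by (auto intro!: derivative_eq_intros)
qed

lemma continuous_angle: "angle F G \<theta> \<Longrightarrow> continuous_on {T1..T2} \<theta>"
  unfolding angle_def by (intro DERIV_continuous_on) auto

text \<open>At such a level the angle has speed \<open>1 / p t > 0\<close>, whatever the weights
  are. It leaves the level upwards at once and cannot come back from above.\<close>

lemma angle_crossing:
  assumes an: "angle F G \<theta>" and l: "cos l = 0" and st: "T1 \<le> s" "s < t" "t \<le> T2" and "\<theta> s \<ge> l"
  shows "\<theta> t > l"
proof (rule ccontr)
  assume "\<not> \<theta> t > l"
  have pos: "pruefer F G x (\<theta> x) > 0" if "\<theta> x = l" "x \<in> {T1..T2}" for x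
  proof -
    have "(sin l)\<^sup>2 = 1" using sin_cos_squared_add[of l] l by simp
    then show ?thesis using that l p_pos[of x] by (simp add: pruefer_def)
  qed
  have der: "(\<theta> has_real_derivative pruefer F G x (\<theta> x)) (at x within {T1..T2})" if "x \<in> {T1..T2}" for x
    using an that by (simp add: angle_def)
  obtain s' where s': "s \<le> s'" "s' < t" "\<theta> s' > l"
  proof (cases "\<theta> s > l")
    case False
    then have "\<theta> s = l" using \<open>\<theta> s \<ge> l\<close> by simp
    from has_real_derivative_pos_inc_right[OF der pos[OF this]] obtain d where
      d: "d > 0" "\<And>h. h > 0 \<Longrightarrow> s + h \<in> {T1..T2} \<Longrightarrow> h < d \<Longrightarrow> \<theta> s < \<theta> (s + h)"
      using st by auto
    obtain h where h: "0 < h" "h < min d (t - s)" using dense[of 0 "min d (t - s)"] d(1) st by auto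
    then show ?thesis using that[of "s + h"] d(2)[of h] st \<open>\<theta> s = l\<close> by auto
  qed (use that[of s] st in auto)
  \<comment> \<open>The least element of \<open>S\<close> is the first return to the level; the
    positive speed there would put the angle below the level just before.\<close>
  define S where "S = {x \<in> {s'..t}. \<theta> x \<le> l}"
  have "continuous_on {s'..t} \<theta>" using s' st by (intro continuous_on_subset[OF continuous_angle[OF an]]) auto
  then have "closed S" unfolding S_def by (intro continuous_on_closed_Collect_le continuous_intros) auto
  moreover have "bounded S" by (rule bounded_subset[of "{s'..t}"]) (auto simp: S_def)
  moreover have "t \<in> S" using s' \<open>\<not> \<theta> t > l\<close> by (simp add: S_def)
  ultimately obtain x where x: "x \<in> S" "\<And>y. y \<in> S \<Longrightarrow> x \<le> y"
    using compact_attains_inf[of S] by (auto simp: compact_eq_bounded_closed)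
  have x': "s' \<le> x" "x \<le> t" "\<theta> x \<le> l" using x(1) by (auto simp: S_def)
  moreover have "x \<noteq> s'" using x'(3) s'(3) by auto
  ultimately have s'x: "s' < x" by simp
  have above: "\<theta> y > l" if "s' \<le> y" "y < x" for y
  proof (rule ccontr)
    assume "\<not> \<theta> y > l"
    then have "y \<in> S" using that x'(2) by (simp add: S_def)
    then show False using x(2)[of y] that by simp
  qed
  have "\<theta> x = l"
  proof (rule ccontr)
    assume "\<theta> x \<noteq> l"
    then have "\<theta> x < l" using x' by simp
    moreover have "continuous_on {s'..x} \<theta>"
      using s' x' st by (intro continuous_on_subset[OF continuous_angle[OF an]]) auto
    ultimately obtain y where "s' \<le> y" "y \<le> x" "\<theta> y = l"
      using IVT2'[of \<theta> x l s'] s' x' by auto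
    then show False using above[of y] \<open>\<theta> x \<noteq> l\<close> by (cases "y = x") auto
  qed
  from has_real_derivative_pos_inc_left[OF der pos[OF this]] obtain d where
    d: "d > 0" "\<And>h. h > 0 \<Longrightarrow> x - h \<in> {T1..T2} \<Longrightarrow> h < d \<Longrightarrow> \<theta> (x - h) < \<theta> x"
    using st s' x' by auto
  obtain h where h: "0 < h" "h < min d (x - s')" using dense[of 0 "min d (x - s')"] d(1) s'x by auto
  then show False using d(2)[of h] above[of "x - h"] st s' x' by auto
qed

text \<open>The angle determines the solution up to a factor: the amplitude obeys a linear equation,
  and the exponential of an integral solves it with a positive function.\<close>

lemma solution_of_angle:
  assumes an: "angle F G \<theta>" and F: "continuous_on {T1..T2} F" and G: "continuous_on {T1..T2} G"
  obtains r u v w where "solution F G u v w" "\<And>t. r t > 0"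
    "\<And>t. u t = r t * cos (\<theta> t)" "\<And>t. v t = - r t * sin (\<theta> t) / p t"
proof -
  note cont = continuous_angle[OF an] F G cont_p cont_q
  have p0: "\<forall>t\<in>{T1..T2}. p t \<noteq> 0" using p_pos by fastforce
  \<comment> \<open>\<open>h\<close> is \<open>- (p u')' / r\<close>, and \<open>R\<close> is the
    logarithmic derivative of the amplitude, read off from
    \<open>r * r' = u * u' + (p u') * (p u')'\<close>.\<close>
  define h where "h t = F t * max (cos (\<theta> t)) 0 - G t * max (- cos (\<theta> t)) 0 - q t * cos (\<theta> t)" for t
  define R where "R t = sin (\<theta> t) * h t - sin (\<theta> t) * cos (\<theta> t) / p t" for t
  define r where "r t = exp (integral {T1..t} R)" for t
  define u where "u t = r t * cos (\<theta> t)" for t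
  define v where "v t = - r t * sin (\<theta> t) / p t" for t
  have contR: "continuous_on {T1..T2} R"
    unfolding R_def h_def using p0 by (intro continuous_intros cont) blast+
  have dr: "(r has_real_derivative r t * R t) (at t within {T1..T2})" if "t \<in> {T1..T2}" for t
    unfolding r_def by (rule derivative_eq_intros integral_has_real_derivative[OF contR that] refl)+
  have pr: "pruefer F G t (\<theta> t) = (sin (\<theta> t))\<^sup>2 / p t + h t * cos (\<theta> t)" for t
  proof -
    have "(max c 0)\<^sup>2 = max c 0 * c" "(max (- c) 0)\<^sup>2 = - (max (- c) 0 * c)" for c :: real
      by (auto simp: max_def power2_eq_square)
    then show ?thesis by (simp add: pruefer_def h_def power2_eq_square[of "cos (\<theta> t)"] algebra_simps)
  qed
  have d\<theta>: "(\<theta> has_real_derivative (sin (\<theta> t))\<^sup>2 / p t + h t * cos (\<theta> t)) (at t within {T1..T2})"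
    if "t \<in> {T1..T2}" for t
    using an that unfolding angle_def pr by blast
  have identities: "\<rho> * (s * \<eta> - s * c / P) * c + - s * (s\<^sup>2 / P + \<eta> * c) * \<rho> = - \<rho> * s * (s\<^sup>2 + c\<^sup>2) / P"
    "- (\<rho> * (s * \<eta> - s * c / P)) * s + c * (s\<^sup>2 / P + \<eta> * c) * - \<rho> = - \<eta> * \<rho> * (s\<^sup>2 + c\<^sup>2)"
    for \<rho> s c P \<eta> :: real
    by (simp_all add: algebra_simps power2_eq_square add_divide_distrib diff_divide_distrib)
  have du: "(u has_real_derivative v t) (at t within {T1..T2})" if t: "t \<in> {T1..T2}" for t
  proof -
    have "r t * R t * cos (\<theta> t) + - sin (\<theta> t) * ((sin (\<theta> t))\<^sup>2 / p t + h t * cos (\<theta> t)) * r t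
        = - r t * sin (\<theta> t) * ((sin (\<theta> t))\<^sup>2 + (cos (\<theta> t))\<^sup>2) / p t"
      unfolding R_def by (rule identities)
    also have "\<dots> = v t" by (simp add: v_def)
    finally show ?thesis unfolding u_def
      by (rule DERIV_cong[OF DERIV_mult[OF dr[OF t] DERIV_chain2[OF DERIV_cos d\<theta>[OF t]]]])
  qed
  have dP: "((\<lambda>t. - r t * sin (\<theta> t)) has_real_derivative - h t * r t) (at t within {T1..T2})"
    if t: "t \<in> {T1..T2}" for t
  proof -
    have "- (r t * R t) * sin (\<theta> t) + cos (\<theta> t) * ((sin (\<theta> t))\<^sup>2 / p t + h t * cos (\<theta> t)) * - r t
        = - h t * r t * ((sin (\<theta> t))\<^sup>2 + (cos (\<theta> t))\<^sup>2)"
      unfolding R_def by (rule identities)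
    also have "\<dots> = - h t * r t" by simp
    finally show ?thesis
      by (rule DERIV_cong[OF DERIV_mult[OF DERIV_minus[OF dr[OF t]] DERIV_chain2[OF DERIV_sin d\<theta>[OF t]]]])
  qed
  have contr: "continuous_on {T1..T2} r" using dr by (rule DERIV_continuous_on)
  have "solution F G u v (\<lambda>t. - h t * r t)"
    unfolding solution_def
  proof (intro conjI ballI)
    show "continuous_on {T1..T2} v"
      unfolding v_def using p0 by (intro continuous_intros cont contr) blast+
  next
    fix t assume t: "t \<in> {T1<..<T2}"
    have "((\<lambda>t. - r t * sin (\<theta> t)) has_real_derivative - h t * r t) (at t)"
      using dP[of t] t at_within_Icc_at[of T1 t T2] by auto
    then show "((\<lambda>s. p s * v s) has_real_derivative - h t * r t) (at t)"
    proof (rule has_field_derivative_transform_within_open[OF _ open_greaterThanLessThan t])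
      fix x assume "x \<in> {T1<..<T2}"
      then show "- r x * sin (\<theta> x) = p x * v x" using p_pos[of x] by (simp add: v_def)
    qed
    have "r t > 0" by (simp add: r_def)
    then have "max (u t) 0 = r t * max (cos (\<theta> t)) 0" "max (- u t) 0 = r t * max (- cos (\<theta> t)) 0"
      by (auto simp: u_def max_def zero_le_mult_iff mult_le_0_iff)
    then show "- h t * r t = q t * u t - (F t * max (u t) 0 - G t * max (- u t) 0)"
      by (simp add: h_def u_def algebra_simps)
  qed (rule du)
  then show ?thesis by (rule that[where r = r]) (simp_all add: r_def u_def v_def)
qed

end


section \<open>Oscillation for large parameters\<close>

context sturm
begin

text \<open>
  While the angle lies in \<open>]-\<pi>/2, \<pi>/2[\<close>, the modified angle \<open>arctan (\<kappa> tan \<theta>)\<close> has speed at least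
  \<open>s\<close>, where \<open>s\<close> is chosen so large that it would leave this interval before \<open>\<beta>\<close>.
\<close>

lemma angle_passes:
  assumes f: "continuous_on {T1..T2} f"
    and ab: "T1 \<le> \<alpha>" "\<alpha> < \<beta>" "\<beta> \<le> T2" and pos: "\<And>t. t \<in> {\<alpha>..\<beta>} \<Longrightarrow> f t > 0"
  shows "\<exists>C. \<forall>c\<ge>C. \<forall>\<theta>. angle (\<lambda>t. c * f t) (\<lambda>t. c * g t) \<theta> \<longrightarrow> \<theta> \<alpha> > - (pi / 2) \<longrightarrow> \<theta> \<beta> > pi / 2"
proof -
  \<comment> \<open>At \<open>\<beta>\<close> itself the angle might equal \<open>pi / 2\<close>,
    where the tangent breaks down. Stopping at the midpoint keeps the cosine positive on the closed
    interval.\<close>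
  define m where "m = (\<alpha> + \<beta>) / 2"
  have m: "\<alpha> < m" "m < \<beta>" using ab by (auto simp: m_def)
  have "continuous_on {\<alpha>..\<beta>} f" using ab by (intro continuous_on_subset[OF f]) auto
  then obtain x where x: "x \<in> {\<alpha>..\<beta>}" "\<And>t. t \<in> {\<alpha>..\<beta>} \<Longrightarrow> f x \<le> f t"
    using continuous_attains_inf[of "{\<alpha>..\<beta>}" f] ab by auto
  define \<eta> where "\<eta> = f x"
  have \<eta>: "\<eta> > 0" "\<And>t. t \<in> {\<alpha>..\<beta>} \<Longrightarrow> \<eta> \<le> f t" using x pos by (auto simp: \<eta>_def)
  obtain Kp where Kp: "Kp > 0" "\<And>t. t \<in> {T1..T2} \<Longrightarrow> \<bar>p t\<bar> \<le> Kp"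
    by (rule continuous_bound[OF cont_p]) blast
  obtain Kq where Kq: "Kq > 0" "\<And>t. t \<in> {T1..T2} \<Longrightarrow> \<bar>q t\<bar> \<le> Kq"
    by (rule continuous_bound[OF cont_q]) blast
  \<comment> \<open>Speed \<open>s\<close> over \<open>{\<alpha>..m}\<close> would increase the
    arctangent by \<open>pi\<close>, more than its range allows. \<open>\<kappa>\<close> and
    \<open>B\<close> solve \<open>\<kappa> * B = s\<close> and
    \<open>\<kappa>\<^sup>2 * B = 1 / Kp\<close>: the second makes the sine part of the angular
    speed large enough, and the choice of \<open>c\<close> does so for the cosine part.\<close>
  define s where "s = pi / (m - \<alpha>)"
  define \<kappa> where "\<kappa> = 1 / (Kp * s)"
  define B where "B = Kp * s\<^sup>2"
  have s: "s > 0" using m by (simp add: s_def)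
  have \<kappa>: "\<kappa> > 0" "\<kappa> * B = s" "\<kappa>\<^sup>2 * B = 1 / Kp"
    using s Kp by (simp_all add: \<kappa>_def B_def power2_eq_square field_simps)
  show ?thesis
  proof (intro exI allI impI)
    fix c \<theta>
    assume c: "(B + Kq) / \<eta> \<le> c" and an: "angle (\<lambda>t. c * f t) (\<lambda>t. c * g t) \<theta>" and start: "\<theta> \<alpha> > - (pi / 2)"
    have cos0: "cos (- (pi / 2)) = 0" "cos (pi / 2) = 0" by simp_all
    show "\<theta> \<beta> > pi / 2"
    proof (rule ccontr)
      assume "\<not> \<theta> \<beta> > pi / 2"
      then have upper: "\<theta> t < pi / 2" if "\<alpha> \<le> t" "t \<le> m" for t
        using angle_crossing[OF an cos0(2), of t \<beta>] that ab m by force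
      have lower: "\<theta> t > - (pi / 2)" if "\<alpha> \<le> t" "t \<le> m" for t
        using angle_crossing[OF an cos0(1), of \<alpha> t] that ab m start by (cases "t = \<alpha>") auto
      have cos_pos: "cos (\<theta> t) > 0" if "\<alpha> \<le> t" "t \<le> m" for t
        using upper[OF that] lower[OF that] by (intro cos_gt_zero_pi) auto
      let ?y = "\<lambda>t. arctan (\<kappa> * tan (\<theta> t))"
      have "?y \<alpha> - s * \<alpha> \<le> ?y m - s * m"
      proof (rule DERIV_nonneg_imp_increasing_open[OF less_imp_le[OF m(1)]])
        have "continuous_on {\<alpha>..m} \<theta>"
          using ab m by (intro continuous_on_subset[OF continuous_angle[OF an]]) auto
        then show "continuous_on {\<alpha>..m} (\<lambda>t. ?y t - s * t)"
          using cos_pos by (intro continuous_intros) force+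
        fix t assume t: "\<alpha> < t" "t < m"
        then have t': "t \<in> {T1..T2}" "T1 < t" "t < T2" "t \<in> {\<alpha>..\<beta>}" using ab m by auto
        define D where "D = pruefer (\<lambda>t. c * f t) (\<lambda>t. c * g t) t (\<theta> t)"
        have d\<theta>: "(\<theta> has_real_derivative D) (at t)"
          using an t'(1) unfolding angle_def D_def at_within_Icc_at[OF t'(2,3), symmetric] by blast
        define S where "S = sin (\<theta> t)"
        define K where "K = cos (\<theta> t)"
        have K: "K > 0" using cos_pos t by (simp add: K_def)
        have tan: "tan (\<theta> t) = S / K" by (simp add: tan_def S_def K_def)
        have "((\<lambda>t. ?y t - s * t) has_real_derivative
            inverse (1 + (\<kappa> * tan (\<theta> t))\<^sup>2) * (\<kappa> * (inverse ((cos (\<theta> t))\<^sup>2) * D)) - s) (at t)"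
          using K unfolding K_def
          by (auto intro!: derivative_eq_intros DERIV_chain2[OF DERIV_arctan] DERIV_chain2[OF DERIV_tan] d\<theta>)
        moreover have "inverse (1 + (\<kappa> * tan (\<theta> t))\<^sup>2) * (\<kappa> * (inverse ((cos (\<theta> t))\<^sup>2) * D)) = \<kappa> * D / (K\<^sup>2 + \<kappa>\<^sup>2 * S\<^sup>2)"
          using K unfolding tan K_def[symmetric] by (simp add: field_simps)
        moreover have "s \<le> \<kappa> * D / (K\<^sup>2 + \<kappa>\<^sup>2 * S\<^sup>2)"
        proof -
          have "1 / Kp \<le> 1 / p t" using p_pos[OF t'(1)] Kp(2)[OF t'(1)] by (intro divide_left_mono) auto
          then have 1: "S\<^sup>2 * (\<kappa>\<^sup>2 * B) \<le> S\<^sup>2 / p t"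
            unfolding \<kappa>(3) using mult_left_mono[of "1 / Kp" "1 / p t" "S\<^sup>2"] by simp
          have "B + Kq \<le> c * \<eta>" using c \<eta> by (simp add: field_simps)
          moreover have "c \<ge> 0" using c \<eta>(1) Kq Kp s by (intro order_trans[OF _ c]) (simp add: B_def)
          then have "c * \<eta> \<le> c * f t" using \<eta>(2)[OF t'(4)] by (intro mult_left_mono)
          ultimately have "B \<le> c * f t - q t" using Kq(2)[OF t'(1)] by linarith
          then have 2: "K\<^sup>2 * B \<le> K\<^sup>2 * (c * f t - q t)" by (intro mult_left_mono) auto
          have "D = S\<^sup>2 / p t + K\<^sup>2 * (c * f t - q t)"
            using K by (simp add: D_def pruefer_def S_def K_def algebra_simps)
          then have "B * (K\<^sup>2 + \<kappa>\<^sup>2 * S\<^sup>2) \<le> D" using 1 2 by (simp add: algebra_simps)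
          then have "\<kappa> * (B * (K\<^sup>2 + \<kappa>\<^sup>2 * S\<^sup>2)) \<le> \<kappa> * D" using \<kappa>(1) by (intro mult_left_mono) auto
          then have "s * (K\<^sup>2 + \<kappa>\<^sup>2 * S\<^sup>2) \<le> \<kappa> * D" unfolding \<kappa>(2)[symmetric] by (simp add: mult.assoc)
          moreover have "K\<^sup>2 + \<kappa>\<^sup>2 * S\<^sup>2 > 0" using K by (simp add: add_pos_nonneg)
          ultimately show ?thesis by (simp add: pos_le_divide_eq)
        qed
        ultimately show "\<exists>y. ((\<lambda>t. ?y t - s * t) has_real_derivative y) (at t) \<and> 0 \<le> y" by auto
      qed
      then have "s * (m - \<alpha>) \<le> ?y m - ?y \<alpha>" by (simp add: algebra_simps)
      moreover have "s * (m - \<alpha>) = pi" using m by (simp add: s_def)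
      ultimately show False
        using arctan_ubound[of "\<kappa> * tan (\<theta> m)"] arctan_lbound[of "\<kappa> * tan (\<theta> \<alpha>)"] by linarith
    qed
  qed
qed

text \<open>Each point of the chain carries the angle over half a turn. The earlier points bring it
  past \<open>- (pi / 2)\<close>, by the induction hypothesis for the angle raised by
  \<open>pi\<close>, which exchanges \<open>f\<close> and \<open>g\<close>; the last point brings it
  past \<open>pi / 2\<close>. The threshold \<open>C\<close> is chosen before
  \<open>\<theta>\<close>, because the angle changes with \<open>c\<close>.\<close>

lemma angle_oscillates:
  assumes "continuous_on {T1..T2} f" "continuous_on {T1..T2} g"
    and "alt_chain (signed_above T1 1 f) (signed_above T1 1 g) j x" "T1 \<le> x" "x \<le> T2"
  shows "\<exists>C. \<forall>c\<ge>C. \<forall>\<theta>. angle (\<lambda>t. c * f t) (\<lambda>t. c * g t) \<theta> \<longrightarrow>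
    \<theta> T1 > pi / 2 - real j * pi \<longrightarrow> \<theta> x > pi / 2"
  using assms
proof (induction j arbitrary: f g x)
  case 0
  have "\<theta> x > pi / 2" if "angle (\<lambda>t. c * f t) (\<lambda>t. c * g t) \<theta>" "\<theta> T1 > pi / 2" for c \<theta>
    using angle_crossing[OF that(1) cos_pi_half, of T1 x] that(2) 0 by (cases "x = T1") auto
  then show ?case by auto
next
  case (Suc j)
  then obtain t where t: "t < x" "signed_above T1 1 f t"
    "alt_chain (signed_above T1 1 g) (signed_above T1 1 f) j t" by auto
  then have t: "t < x" "T1 < t" "f t > 0" "alt_chain (signed_above T1 1 g) (signed_above T1 1 f) j t"
    by (simp_all add: signed_above_def[of T1 1 f t])
  from Suc.IH[OF Suc.prems(2,1) t(4)] t Suc.prems obtain C1 where C1: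
    "\<And>c \<theta>. c \<ge> C1 \<Longrightarrow> angle (\<lambda>t. c * g t) (\<lambda>t. c * f t) \<theta> \<Longrightarrow> \<theta> T1 > pi / 2 - real j * pi \<Longrightarrow> \<theta> t > pi / 2"
    by force
  obtain \<beta> where \<beta>: "t < \<beta>" "\<beta> < x" "\<And>y. y \<in> {t..\<beta>} \<Longrightarrow> f y > 0"
  proof -
    have "continuous (at t within {T1..T2}) f"
      using Suc.prems(1,5) t by (auto simp: continuous_on_eq_continuous_within)
    then obtain d where d: "d > 0" "\<And>y. y \<in> {T1..T2} \<Longrightarrow> dist y t < d \<Longrightarrow> dist (f y) (f t) < f t"
      using t(3) unfolding continuous_within_eps_delta by blast
    obtain \<beta> where "t < \<beta>" "\<beta> < min x (t + d)" using dense[of t "min x (t + d)"] t d by auto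
    moreover have "f y > 0" if "y \<in> {t..\<beta>}" for y
      using d(2)[of y] that calculation t Suc.prems by (auto simp: dist_real_def)
    ultimately show ?thesis using that by auto
  qed
  obtain C2 where C2:
    "\<And>c \<theta>. c \<ge> C2 \<Longrightarrow> angle (\<lambda>t. c * f t) (\<lambda>t. c * g t) \<theta> \<Longrightarrow> \<theta> t > - (pi / 2) \<Longrightarrow> \<theta> \<beta> > pi / 2"
    using angle_passes[OF Suc.prems(1), of t \<beta> g] \<beta> t Suc.prems by force
  have "\<theta> x > pi / 2" if c: "max C1 C2 \<le> c" and an: "angle (\<lambda>t. c * f t) (\<lambda>t. c * g t) \<theta>"
    and start: "\<theta> T1 > pi / 2 - real (Suc j) * pi" for c \<theta>
  proof -
    have "\<theta> t + pi > pi / 2"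
      using C1[OF _ angle_shift[OF an]] c start by (simp add: algebra_simps)
    then have "\<theta> \<beta> > pi / 2" using C2[OF _ an] c by simp
    then show ?thesis using angle_crossing[OF an cos_pi_half, of \<beta> x] \<beta> t Suc.prems by simp
  qed
  then show ?case by blast
qed

text \<open>Reaching \<open>pi / 2\<close> would give a solution that starts with slope zero, is
  positive and then vanishes, although its flux is monotone because \<open>q\<close> is
  nonnegative.\<close>

lemma angle_without_weights:
  assumes an: "angle (\<lambda>t. 0) (\<lambda>t. 0) \<theta>" and "\<theta> T1 = 0"
  shows "\<theta> T2 < pi / 2"
proof (rule ccontr)
  assume "\<not> \<theta> T2 < pi / 2"
  then obtain z where z: "T1 \<le> z" "z \<le> T2" "\<theta> z = pi / 2"
    using IVT'[of \<theta> T1 "pi / 2" T2] continuous_angle[OF an] T1_less_T2 \<open>\<theta> T1 = 0\<close> by auto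
  then have "T1 < z" using \<open>\<theta> T1 = 0\<close> by (cases "z = T1") auto
  obtain r u v w where sol: "solution (\<lambda>t. 0) (\<lambda>t. 0) u v w" and r: "\<And>t. r t > 0"
    and u: "\<And>t. u t = r t * cos (\<theta> t)" and v: "\<And>t. v t = - r t * sin (\<theta> t) / p t"
    using solution_of_angle[OF an] by (metis continuous_on_const)
  have "u t > 0" if t: "T1 < t" "t < z" for t
  proof -
    have "\<theta> t > - (pi / 2)" using angle_crossing[OF an, of "- (pi / 2)" T1 t] t z \<open>\<theta> T1 = 0\<close> by simp
    moreover have "\<theta> t < pi / 2" using angle_crossing[OF an, of "pi / 2" t z] t z by force
    ultimately show ?thesis using r[of t] by (simp add: u cos_gt_zero_pi)
  qed
  then have "u z > 0"
    using flux_monotone(1)[OF sol order_refl \<open>T1 < z\<close> z(2)] v[of T1] \<open>\<theta> T1 = 0\<close> by simp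
  then show False using z(3) by (simp add: u)
qed

lemma angle_shift_multiple:
  assumes "angle (\<lambda>t. 0) (\<lambda>t. 0) \<theta>"
  shows "angle (\<lambda>t. 0) (\<lambda>t. 0) (\<lambda>t. \<theta> t + real k * pi)"
proof (induction k)
  case (Suc k)
  have "(\<lambda>t. \<theta> t + real (Suc k) * pi) = (\<lambda>t. \<theta> t + real k * pi + pi)" by (auto simp: algebra_simps)
  then show ?case using angle_shift[OF Suc] by simp
qed (use assms in simp)

text \<open>
  The angle crosses the zeros of the cosine only upwards, so an angle running from \<open>- k \<pi>\<close> to \<open>0\<close>
  passes each of the \<open>k\<close> zeros in between exactly once.
\<close>

lemma angle_zeros:
  assumes an: "angle F G \<theta>" and ends: "\<theta> T1 = - (real k * pi)" "\<theta> T2 = 0"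
  shows "finite {t \<in> {T1<..<T2}. cos (\<theta> t) = 0} \<and> card {t \<in> {T1<..<T2}. cos (\<theta> t) = 0} = k"
proof -
  \<comment> \<open>The zeros of the cosine, listed downwards from \<open>- (pi / 2)\<close>; those
    with \<open>j < k\<close> are the ones between \<open>- k * pi\<close> and
    \<open>0\<close>.\<close>
  define l where "l j = pi / 2 - real (Suc j) * pi" for j :: nat
  have cosl: "cos (l j) = 0" for j
  proof (induction j)
    case 0
    have "l 0 = - (pi / 2)" by (simp add: l_def)
    then show ?case by simp
  next
    case (Suc j)
    have "l (Suc j) = l j - pi" by (simp add: l_def algebra_simps)
    then show ?case using Suc by (simp add: cos_diff)
  qed
  have "\<exists>t. T1 < t \<and> t < T2 \<and> \<theta> t = l j" if "j < k" for j
  proof -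
    have "real j + 1 \<le> real k" using that by simp
    then have "(real j + 1) * pi \<le> real k * pi" by (intro mult_right_mono) auto
    then have "real j * pi + pi \<le> real k * pi" by (simp add: algebra_simps)
    moreover have "l j = - (pi / 2) - real j * pi" "real j * pi \<ge> 0" by (simp_all add: l_def algebra_simps)
    ultimately have b: "- (real k * pi) < l j" "l j < 0" using pi_gt_zero by linarith+
    then obtain t where t: "T1 \<le> t" "t \<le> T2" "\<theta> t = l j"
      using IVT'[of \<theta> T1 "l j" T2] continuous_angle[OF an] T1_less_T2 ends by auto
    then have "t \<noteq> T1" "t \<noteq> T2" using b ends by auto
    then show ?thesis using t by force
  qed
  then obtain z where z: "\<And>j. j < k \<Longrightarrow> T1 < z j \<and> z j < T2 \<and> \<theta> (z j) = l j" by metis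
  have "{t \<in> {T1<..<T2}. cos (\<theta> t) = 0} = z ` {..<k}"
  proof (intro set_eqI iffI)
    fix t assume "t \<in> {t \<in> {T1<..<T2}. cos (\<theta> t) = 0}"
    then have t: "T1 < t" "t < T2" "cos (\<theta> t) = 0" by auto
    then obtain i :: int where i: "odd i" "\<theta> t = of_int i * (pi / 2)"
      using cos_zero_iff_int by blast
    have "\<theta> t < 0"
    proof (rule ccontr)
      assume "\<not> \<theta> t < 0"
      then have "\<theta> T2 > \<theta> t" using angle_crossing[OF an t(3), of t T2] t by simp
      then show False using \<open>\<not> \<theta> t < 0\<close> ends by simp
    qed
    then have "i < 0" using i by (simp add: mult_less_0_iff)
    define j where "j = nat ((- i - 1) div 2)"
    have ij: "i = - (2 * int j) - 1" using i(1) \<open>i < 0\<close> by (auto simp: j_def elim!: oddE)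
    have tl: "\<theta> t = l j" unfolding i(2) ij by (simp add: l_def algebra_simps)
    have "j < k"
    proof (rule ccontr)
      assume "\<not> j < k"
      then have "real k * pi \<le> real j * pi" by (intro mult_right_mono) auto
      moreover have "l j = - (pi / 2) - real j * pi" by (simp add: l_def algebra_simps)
      ultimately have "\<theta> T1 \<ge> \<theta> t" unfolding tl ends using pi_gt_zero by linarith
      then have "\<theta> t > \<theta> t" using angle_crossing[OF an t(3), of T1 t] t by simp
      then show False by simp
    qed
    have "t = z j"
    proof (rule ccontr)
      assume "t \<noteq> z j"
      then consider "t < z j" | "z j < t" by linarith
      then show False
        using angle_crossing[OF an cosl, of t "z j" j] angle_crossing[OF an cosl, of "z j" t j] z[OF \<open>j < k\<close>] t tl
        by cases auto
    qed
    then show "t \<in> z ` {..<k}" using \<open>j < k\<close> by blast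
  next
    fix t assume "t \<in> z ` {..<k}"
    then show "t \<in> {t \<in> {T1<..<T2}. cos (\<theta> t) = 0}" using z cosl by auto
  qed
  moreover have "inj_on z {..<k}"
  proof (rule inj_onI)
    fix i j assume "i \<in> {..<k}" "j \<in> {..<k}" "z i = z j"
    then have "l i = l j" using z[of i] z[of j] by auto
    then show "i = j" by (simp add: l_def)
  qed
  ultimately show ?thesis by (simp add: card_image)
qed

lemma alt_chain_solution:
  assumes f: "continuous_on {T1..T2} f" and g: "continuous_on {T1..T2} g" and "1 \<le> k"
    and ch: "alt_chain (signed_above T1 1 f) (signed_above T1 1 g) (Suc k) T2"
  shows "\<exists>c u v w. 0 \<le> c \<and> solution (\<lambda>t. c * f t) (\<lambda>t. c * g t) u v w \<and> v T1 = 0 \<and> v T2 = 0 \<and> u T2 > 0 \<and>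
    has_exactly_zeros T1 T2 k u"
proof -
  have contc: "continuous_on {T1..T2} (\<lambda>t. c * f t)" "continuous_on {T1..T2} (\<lambda>t. c * g t)" for c
    by (intro continuous_intros f g)+
  have "\<exists>\<theta>. \<forall>c. angle (\<lambda>t. c * f t) (\<lambda>t. c * g t) (\<theta> c) \<and> \<theta> c T1 = - (real k * pi)"
    by (intro choice allI angle_exists contc)
  then obtain \<theta> where \<theta>: "\<And>c. angle (\<lambda>t. c * f t) (\<lambda>t. c * g t) (\<theta> c)" "\<And>c. \<theta> c T1 = - (real k * pi)"
    by blast
  \<comment> \<open>Raised by \<open>k * pi\<close>, the angle starts at \<open>0\<close> and ends
    below \<open>pi / 2\<close>; as \<open>k \<ge> 1\<close>, lowering it again gives a negative end
    value.\<close>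
  have low: "\<theta> 0 T2 \<le> 0"
  proof -
    have "angle (\<lambda>t. 0) (\<lambda>t. 0) (\<lambda>t. \<theta> 0 t + real k * pi)" using angle_shift_multiple \<theta>(1)[of 0] by simp
    then have "\<theta> 0 T2 + real k * pi < pi / 2" using angle_without_weights \<theta>(2)[of 0] by fastforce
    moreover have "1 * pi \<le> real k * pi" using \<open>1 \<le> k\<close> by (intro mult_right_mono) auto
    ultimately show ?thesis using pi_gt_zero by linarith
  qed
  \<comment> \<open>The chain has \<open>k + 1\<close> points, and the start \<open>- k * pi\<close>
    exceeds the required \<open>pi / 2 - (k + 1) * pi\<close> by \<open>pi / 2\<close>.\<close>
  obtain C0 where C0: "\<And>c. c \<ge> C0 \<Longrightarrow> \<theta> c T2 > pi / 2"
    using angle_oscillates[OF f g ch] T1_less_T2 \<theta> by (fastforce simp: algebra_simps)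
  define C where "C = max 0 C0"
  have "C0 \<le> C" by (simp add: C_def)
  then have high: "\<theta> C T2 \<ge> 0" using C0[of C] pi_gt_zero by linarith
  obtain K where K: "\<And>c c' \<theta> \<phi>. \<lbrakk>\<bar>c\<bar> \<le> C; angle (\<lambda>t. c * f t) (\<lambda>t. c * g t) \<theta>;
      angle (\<lambda>t. c' * f t) (\<lambda>t. c' * g t) \<phi>; \<theta> T1 = \<phi> T1\<rbrakk> \<Longrightarrow> \<bar>\<theta> T2 - \<phi> T2\<bar> \<le> K * \<bar>c - c'\<bar>"
    by (rule angle_dependence[OF f g, where C = C]) blast
  have "\<bar>K\<bar>-lipschitz_on {0..C} (\<lambda>c. \<theta> c T2)"
  proof (rule lipschitz_onI)
    fix c c' assume "c \<in> {0..C}" "c' \<in> {0..C}"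
    then have "\<bar>\<theta> c T2 - \<theta> c' T2\<bar> \<le> K * \<bar>c - c'\<bar>" using K[OF _ \<theta>(1) \<theta>(1)] \<theta>(2) by simp
    also have "\<dots> \<le> \<bar>K\<bar> * \<bar>c - c'\<bar>" by (intro mult_right_mono) auto
    finally show "dist (\<theta> c T2) (\<theta> c' T2) \<le> \<bar>K\<bar> * dist c c'" by (simp add: dist_real_def)
  qed simp
  then have "continuous_on {0..C} (\<lambda>c. \<theta> c T2)" by (rule lipschitz_on_continuous_on)
  then obtain c where c: "0 \<le> c" "\<theta> c T2 = 0"
    using IVT'[of "\<lambda>c. \<theta> c T2" 0 0 C] low high by (auto simp: C_def)
  obtain r u v w where sol: "solution (\<lambda>t. c * f t) (\<lambda>t. c * g t) u v w" and r: "\<And>t. r t > 0"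
    and u: "\<And>t. u t = r t * cos (\<theta> c t)" and v: "\<And>t. v t = - r t * sin (\<theta> c t) / p t"
    using solution_of_angle[OF \<theta>(1) contc] by metis
  have "v T1 = 0" "v T2 = 0" "u T2 > 0" using \<theta>(2)[of c] c r[of T2] by (simp_all add: u v)
  moreover have "u t = 0 \<longleftrightarrow> cos (\<theta> c t) = 0" for t using r[of t] by (simp add: u)
  then have "has_exactly_zeros T1 T2 k u"
    using angle_zeros[OF \<theta>(1) \<theta>(2) c(2)] by (simp add: has_exactly_zeros_def)
  ultimately show ?thesis using sol c(1) by blast
qed

end


section \<open>Counting curves\<close>

context sturm
begin

lemma neumann_solution_iff:
  "neumann_solution T1 T2 p q m n a b u \<longleftrightarrow>
    (\<exists>v w. solution (\<lambda>t. a * m t) (\<lambda>t. b * n t) u v w \<and> v T1 = 0 \<and> v T2 = 0)"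
proof -
  have "(- w + x = y - z) = (w = x - (y - z))" for w x y z :: real by linarith
  then show ?thesis unfolding neumann_solution_def solution_def by (simp only: conj_assoc)
qed

text \<open>Passing to \<open>- u\<close> exchanges the positive and the negative part, so results
  on \<open>C_gt\<close> carry over to \<open>C_lt\<close>.\<close>

lemma C_lt_swap: "(a, b) \<in> C_lt T1 T2 p q m n k \<longleftrightarrow> (b, a) \<in> C_gt T1 T2 p q n m k"
proof -
  have minus: "neumann_solution T1 T2 p q n' m' b' a' (\<lambda>t. - u t)"
    if "neumann_solution T1 T2 p q m' n' a' b' u" for m' n' a' b' u
    using that solution_minus unfolding neumann_solution_iff by (metis neg_0_equal_iff_equal)
  show ?thesis
  proof
    assume "(a, b) \<in> C_lt T1 T2 p q m n k"
    then obtain u where "nontrivial_neumann_solution T1 T2 p q m n a b u" "has_exactly_zeros T1 T2 k u" "u T2 < 0"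
      by (auto simp: C_lt_def)
    then show "(b, a) \<in> C_gt T1 T2 p q n m k"
      unfolding C_gt_def
      by (auto simp: nontrivial_neumann_solution_def has_exactly_zeros_def intro!: exI[of _ "\<lambda>t. - u t"] minus)
  next
    assume "(b, a) \<in> C_gt T1 T2 p q n m k"
    then obtain u where "nontrivial_neumann_solution T1 T2 p q n m b a u" "has_exactly_zeros T1 T2 k u" "u T2 > 0"
      by (auto simp: C_gt_def)
    then show "(a, b) \<in> C_lt T1 T2 p q m n k"
      unfolding C_lt_def
      by (auto simp: nontrivial_neumann_solution_def has_exactly_zeros_def intro!: exI[of _ "\<lambda>t. - u t"] minus)
  qed
qed

text \<open>\<open>u T2 > 0\<close> makes the last nodal interval positive, so the chain ends with
  the first weight. From \<open>\<sigma> * a \<ge> 0\<close> and \<open>a * m t > 0\<close> it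
  follows that \<open>a\<close> is nonzero and \<open>\<sigma> * m t > 0\<close>, which also settles
  the points on the axes.\<close>

lemma C_gt_imp_alt_chain:
  assumes m: "continuous_on {T1..T2} m" and n: "continuous_on {T1..T2} n" and "1 \<le> k"
    and \<sigma>: "\<sigma> \<in> {1, -1}" and \<tau>: "\<tau> \<in> {1, -1}" and a: "\<sigma> * a \<ge> 0" and b: "\<tau> * b \<ge> 0"
    and ab: "(a, b) \<in> C_gt T1 T2 p q m n k"
  shows "alt_chain (signed_above T1 \<sigma> m) (signed_above T1 \<tau> n) (Suc k) T2"
proof -
  obtain u v w where sol: "solution (\<lambda>t. a * m t) (\<lambda>t. b * n t) u v w" "v T1 = 0" "v T2 = 0"
    and zeros: "has_exactly_zeros T1 T2 k u" and pos: "u T2 > 0"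
    using ab by (auto simp: C_gt_def nontrivial_neumann_solution_def neumann_solution_iff)
  have cont: "continuous_on {T1..T2} (\<lambda>t. a * m t)" "continuous_on {T1..T2} (\<lambda>t. b * n t)"
    by (intro continuous_intros m n)+
  have "alt_chain (signed_above T1 1 (\<lambda>t. a * m t)) (signed_above T1 1 (\<lambda>t. b * n t)) (Suc k) T2"
  proof (rule nodal_alt_chain[OF sol(1,2)])
    show "v t \<noteq> 0" if "t \<in> {T1..T2}" "u t = 0" for t
      using double_zero[OF sol(1) cont that(1,2), of T2] pos T1_less_T2 by auto
    have "continuous (at T2 within {T1..T2}) u"
      using solution_continuous(1)[OF sol(1)] T1_less_T2 by (auto simp: continuous_on_eq_continuous_within)
    then obtain d where d: "d > 0" "\<And>y. y \<in> {T1..T2} \<Longrightarrow> dist y T2 < d \<Longrightarrow> dist (u y) (u T2) < u T2"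
      using pos unfolding continuous_within_eps_delta by blast
    show "\<exists>y\<in>{T1..<T2}. \<forall>t\<in>{y<..<T2}. 0 < u t"
    proof (intro bexI ballI)
      fix t assume "t \<in> {max T1 (T2 - d)<..<T2}"
      then show "0 < u t" using d(2)[of t] by (auto simp: dist_real_def)
    qed (use d T1_less_T2 in auto)
  qed (use T1_less_T2 zeros sol \<open>1 \<le> k\<close> in \<open>auto simp: has_exactly_zeros_def\<close>)
  then show ?thesis
    by (rule alt_chain_weaken)
      (use \<sigma> \<tau> a b in \<open>auto simp: signed_above_def zero_less_mult_iff\<close>)
qed

lemma alt_chain_imp_C_gt:
  assumes m: "continuous_on {T1..T2} m" and n: "continuous_on {T1..T2} n" and "1 \<le> k"
    and \<sigma>: "\<sigma> \<in> {1, -1}" and \<tau>: "\<tau> \<in> {1, -1}"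
    and ch: "alt_chain (signed_above T1 \<sigma> m) (signed_above T1 \<tau> n) (Suc k) T2"
  shows "\<exists>a b. \<sigma> * a \<ge> 0 \<and> \<tau> * b \<ge> 0 \<and> (a, b) \<in> C_gt T1 T2 p q m n k"
proof -
  have cont: "continuous_on {T1..T2} (\<lambda>t. \<sigma> * m t)" "continuous_on {T1..T2} (\<lambda>t. \<tau> * n t)"
    by (intro continuous_intros m n)+
  have "alt_chain (signed_above T1 1 (\<lambda>t. \<sigma> * m t)) (signed_above T1 1 (\<lambda>t. \<tau> * n t)) (Suc k) T2"
    using ch by (rule alt_chain_weaken) (auto simp: signed_above_def)
  from alt_chain_solution[OF cont \<open>1 \<le> k\<close> this] obtain c u v w where
    c: "0 \<le> c" "solution (\<lambda>t. c * (\<sigma> * m t)) (\<lambda>t. c * (\<tau> * n t)) u v w" "v T1 = 0" "v T2 = 0"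
    and u: "u T2 > 0" "has_exactly_zeros T1 T2 k u" by blast
  have "neumann_solution T1 T2 p q m n (c * \<sigma>) (c * \<tau>) u"
    unfolding neumann_solution_iff mult.assoc using c by blast
  moreover have "\<exists>t\<in>{T1..T2}. u t \<noteq> 0" using u(1) T1_less_T2 by (intro bexI[of _ T2]) auto
  ultimately have "(c * \<sigma>, c * \<tau>) \<in> C_gt T1 T2 p q m n k"
    using u unfolding C_gt_def nontrivial_neumann_solution_def by blast
  moreover have "\<sigma> * (c * \<sigma>) \<ge> 0" "\<tau> * (c * \<tau>) \<ge> 0" using c \<sigma> \<tau> by auto
  ultimately show ?thesis by blast
qed

definition quadrant :: "real \<Rightarrow> real \<Rightarrow> (real \<times> real) set" where
  "quadrant \<sigma> \<tau> = {(a, b). \<sigma> * a \<ge> 0 \<and> \<tau> * b \<ge> 0}"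

lemma C_gt_meets_quadrant:
  assumes "continuous_on {T1..T2} m" "continuous_on {T1..T2} n" "1 \<le> k"
    and "\<sigma> \<in> {1, -1}" "\<tau> \<in> {1, -1}"
  shows "C_gt T1 T2 p q m n k \<inter> quadrant \<sigma> \<tau> \<noteq> {} \<longleftrightarrow>
    alt_chain (signed_above T1 \<sigma> m) (signed_above T1 \<tau> n) (Suc k) T2"
  using C_gt_imp_alt_chain[OF assms] alt_chain_imp_C_gt[OF assms] unfolding quadrant_def by blast

lemma C_lt_meets_quadrant:
  assumes "continuous_on {T1..T2} m" "continuous_on {T1..T2} n" "1 \<le> k"
    and "\<sigma> \<in> {1, -1}" "\<tau> \<in> {1, -1}"
  shows "C_lt T1 T2 p q m n k \<inter> quadrant \<sigma> \<tau> \<noteq> {} \<longleftrightarrow>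
    alt_chain (signed_above T1 \<tau> n) (signed_above T1 \<sigma> m) (Suc k) T2"
proof -
  have "C_lt T1 T2 p q m n k \<inter> quadrant \<sigma> \<tau> \<noteq> {} \<longleftrightarrow>
    C_gt T1 T2 p q n m k \<inter> quadrant \<tau> \<sigma> \<noteq> {}"
    using C_lt_swap unfolding quadrant_def by blast
  then show ?thesis using C_gt_meets_quadrant[OF assms(2,1,3,5,4)] by (simp only:)
qed

lemma num_hyperbolic_curves_blocks:
  assumes "w \<noteq> []" and \<sigma>\<tau>: "\<sigma> \<in> {1, -1}" "\<tau> \<in> {1, -1}"
  defines "h \<equiv> (T2 - T1) / real (length w)"
  shows "num_hyperbolic_curves T1 T2 p q (blocks T1 h (map fst w)) (blocks T1 h (map snd w))
    (quadrant \<sigma> \<tau>) = count_word \<sigma> \<tau> w"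
  unfolding num_hyperbolic_curves_def ecard_alt_chain_blocks[OF T1_less_T2 assms(1), symmetric] h_def
  using C_gt_meets_quadrant[OF continuous_on_blocks continuous_on_blocks _ \<sigma>\<tau>]
    C_lt_meets_quadrant[OF continuous_on_blocks continuous_on_blocks _ \<sigma>\<tau>]
  by (intro arg_cong2[where f = "(+)"] arg_cong[where f = ecard] Collect_cong conj_cong refl) assumption+

text \<open>A curve with \<open>k \<ge> 1\<close> comes from a chain of at least two points, so both
  weights are positive somewhere. A nonzero count in a single quadrant is therefore enough.\<close>

lemma nonzero_weights:
  assumes m: "continuous_on {T1..T2} m" and n: "continuous_on {T1..T2} n"
    and "num_hyperbolic_curves T1 T2 p q m n (quadrant 1 1) \<noteq> 0"
  shows "(\<exists>t\<in>{T1..T2}. m t \<noteq> 0) \<and> (\<exists>t\<in>{T1..T2}. n t \<noteq> 0)"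
proof -
  have "\<exists>k\<ge>1. alt_chain (signed_above T1 1 m) (signed_above T1 1 n) (Suc k) T2 \<or>
      alt_chain (signed_above T1 1 n) (signed_above T1 1 m) (Suc k) T2"
  proof (rule ccontr)
    assume none: "\<not> ?thesis"
    have "{k. k \<ge> 1 \<and> C_gt T1 T2 p q m n k \<inter> quadrant 1 1 \<noteq> {}} = {}"
      using none C_gt_meets_quadrant[OF m n, of _ 1 1] by blast
    moreover have "{k. k \<ge> 1 \<and> C_lt T1 T2 p q m n k \<inter> quadrant 1 1 \<noteq> {}} = {}"
      using none C_lt_meets_quadrant[OF m n, of _ 1 1] by blast
    ultimately show False
      using assms(3) unfolding num_hyperbolic_curves_def by (simp only: ecard_def) (simp add: zero_enat_def)
  qed
  then obtain k where "k \<ge> 1" and "alt_chain (signed_above T1 1 m) (signed_above T1 1 n) (Suc k) T2 \<or>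
      alt_chain (signed_above T1 1 n) (signed_above T1 1 m) (Suc k) T2" by blast
  moreover obtain j where "k = Suc j" using \<open>k \<ge> 1\<close> by (cases k) auto
  ultimately obtain s t where "signed_above T1 1 m s" "s < T2" "signed_above T1 1 n t" "t < T2"
    by (auto intro: less_trans)
  then show ?thesis unfolding signed_above_def by (intro conjI bexI[of _ s] bexI[of _ t]) auto
qed

end


theorem theorem5:
  fixes T1 T2 :: real
    and p q :: "real \<Rightarrow> real"
    and p0 q0 r0 s0 :: enat
  assumes "T1 < T2"
    and "continuous_on {T1..T2} p"
    and "continuous_on {T1..T2} q"
    and "\<And>t. t \<in> {T1..T2} \<Longrightarrow> p t > 0"
    and "\<And>t. t \<in> {T1..T2} \<Longrightarrow> q t \<ge> 0"
  shows "\<exists>m n :: real \<Rightarrow> real.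
    continuous_on {T1..T2} m \<and> continuous_on {T1..T2} n \<and>
    (\<exists>t\<in>{T1..T2}. m t \<noteq> 0) \<and> (\<exists>t\<in>{T1..T2}. n t \<noteq> 0) \<and>
    num_hyperbolic_curves T1 T2 p q m n ({0..} \<times> {0..}) = 2 * p0 + 1 \<and>
    num_hyperbolic_curves T1 T2 p q m n ({0..} \<times> {..0}) = 2 * q0 + 1 \<and>
    num_hyperbolic_curves T1 T2 p q m n ({..0} \<times> {..0}) = 2 * r0 + 1 \<and>
    num_hyperbolic_curves T1 T2 p q m n ({..0} \<times> {0..}) = 2 * s0 + 1"
proof -
  interpret sturm T1 T2 p q using assms by unfold_locales auto
  obtain w where w: "count_word 1 1 w = 2 * p0 + 1" "count_word 1 (-1) w = 2 * q0 + 1"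
    "count_word (-1) (-1) w = 2 * r0 + 1" "count_word (-1) 1 w = 2 * s0 + 1"
    using exists_word by blast
  \<comment> \<open>The empty word has count zero, which is not of the form
    \<open>2 * p0 + 1\<close>; a nonempty word makes the cell width \<open>h\<close>
    meaningful.\<close>
  have "w \<noteq> []" using w(1) by (auto simp: count_word_def)
  define h where "h = (T2 - T1) / real (length w)"
  define m where "m = blocks T1 h (map fst w)"
  define n where "n = blocks T1 h (map snd w)"
  have count: "num_hyperbolic_curves T1 T2 p q m n (quadrant \<sigma> \<tau>) = count_word \<sigma> \<tau> w"
    if "\<sigma> \<in> {1, -1}" "\<tau> \<in> {1, -1}" for \<sigma> \<tau>
    unfolding m_def n_def h_def using \<open>w \<noteq> []\<close> that by (rule num_hyperbolic_curves_blocks)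
  have quadrants: "{0..} \<times> {0..} = quadrant 1 1" "{0..} \<times> {..0} = quadrant 1 (-1)"
    "{..0} \<times> {..0} = quadrant (-1) (-1)" "{..0} \<times> {0..} = quadrant (-1) 1"
    by (auto simp: quadrant_def)
  have cont: "continuous_on {T1..T2} m" "continuous_on {T1..T2} n"
    by (simp_all add: m_def n_def continuous_on_blocks)
  have "num_hyperbolic_curves T1 T2 p q m n (quadrant 1 1) \<noteq> 0"
    using count[of 1 1] w(1) by simp
  from nonzero_weights[OF cont this] show ?thesis
    unfolding quadrants using cont count[of 1 1] count[of 1 "-1"] count[of "-1" "-1"] count[of "-1" 1] w
    by (intro exI[of _ m] exI[of _ n]) simp
qed

end
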